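(* Let $\Omega$ be a domain in $\mathbb{C}$ and let $A\subset(\mathbb{C}\cup\{\infty\})\setminus\Omega$ be a set containing $\infty$ and a point from each bounded component of $\mathbb{C}\setminus\Omega$. Let $f\equiv\infty$ on $\Omega$ or let $f:\Omega\to\mathbb{C}$ be holomorphic. Then $f$ is the $\chi$-uniform limit on each compact subset of $\Omega$ of a sequence of functions of the form $$h(s)=P_0(s)+\sum_{j=1}^{N}P_j\left(\frac{1}{s-z_j}\right),$$ where $P_j$ are Dirichlet polynomials for $j=0,\ldots,N$, $z_j\in A\setminus\{\infty\}$ for $j=1,\ldots,N$, and $N\in\mathbb{N}$. Conversely, every $\chi$-uniform limit on each compact subset of $\Omega$ of a sequence of functions of the form of $h$ is either constant equal to $\infty$ or holomorphic in $\Omega$.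
   Context: A Dirichlet polynomial is a function $P(s)=\sum_{n=1}^{M}a_n\frac{1}{n^s}$ with $M\in\mathbb{N}$, $a_n\in\mathbb{C}$. $\chi$ is the chordal distance on $\mathbb{C}\cup\{\infty\}$: $\chi(a,b)=\frac{|a-b|}{\sqrt{1+|a|^2}\sqrt{1+|b|^2}}$ for $a,b\in\mathbb{C}$, $\chi(a,\infty)=\chi(\infty,a)=\frac{1}{\sqrt{1+|a|^2}}$ for $a\in\mathbb{C}$, $\chi(\infty,\infty)=0$. $\chi$-uniform convergence is uniform convergence with respect to $\chi$. If $A\setminus\{\infty\}$ is empty, only the term $P_0$ occurs in $h$. *)

theory Defs
  imports "HOL-Complex_Analysis.Complex_Analysis"
begin

text \<open>The extended plane is modelled as \<open>complex option\<close> with \<open>None\<close> as the point at infinity, as in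
  the library's one-point compactification \<^const>\<open>Alexandroff_compactification\<close>.\<close>

type_synonym ecomplex = "complex option"

fun chordal :: "ecomplex \<Rightarrow> ecomplex \<Rightarrow> real" where
  "chordal (Some a) (Some b) = cmod (a - b) / (sqrt (1 + (cmod a)\<^sup>2) * sqrt (1 + (cmod b)\<^sup>2))"
| "chordal (Some a) None = 1 / sqrt (1 + (cmod a)\<^sup>2)"
| "chordal None (Some a) = 1 / sqrt (1 + (cmod a)\<^sup>2)"
| "chordal None None = 0"

definition chordal_uniform_limit ::
    "complex set \<Rightarrow> (nat \<Rightarrow> complex \<Rightarrow> ecomplex) \<Rightarrow> (complex \<Rightarrow> ecomplex) \<Rightarrow> bool" where
  "chordal_uniform_limit K F f \<longleftrightarrow>
     (\<forall>\<epsilon>>0. \<forall>\<^sub>F k in sequentially. \<forall>s\<in>K. chordal (F k s) (f s) < \<epsilon>)"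

definition dirichlet_polynomial :: "(complex \<Rightarrow> complex) \<Rightarrow> bool" where
  "dirichlet_polynomial P \<longleftrightarrow>
     (\<exists>(M::nat) (a :: nat \<Rightarrow> complex). P = (\<lambda>s. \<Sum>n=1..M. a n * (1 / of_nat n powr s)))"

text \<open>The approximating functions \<open>h\<close>, with singularities \<open>z j\<close> in \<open>A\<close>. The case
  \<open>N = 0\<close> is the one in which only \<open>P\<^sub>0\<close> occurs; since the zero function is a Dirichlet polynomial,
  allowing it adds no functions when \<open>A\<close> contains a finite point. The value given to \<open>h\<close> at the
  \<open>z j\<close> by division by zero is immaterial, as \<open>h\<close> is only considered on a set avoiding \<open>A\<close>.\<close>

definition dirichlet_approximant :: "ecomplex set \<Rightarrow> (complex \<Rightarrow> complex) \<Rightarrow> bool" where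
  "dirichlet_approximant A h \<longleftrightarrow>
     (\<exists>P\<^sub>0 (N::nat) P z.
        dirichlet_polynomial P\<^sub>0 \<and>
        (\<forall>j\<in>{1..N}. dirichlet_polynomial (P j) \<and> Some (z j) \<in> A) \<and>
        h = (\<lambda>s. P\<^sub>0 s + (\<Sum>j=1..N. P j (1 / (s - z j)))))"

definition infinite_or_holomorphic_on :: "(complex \<Rightarrow> ecomplex) \<Rightarrow> complex set \<Rightarrow> bool" where
  "infinite_or_holomorphic_on f \<Omega> \<longleftrightarrow>
     (\<forall>s\<in>\<Omega>. f s = None) \<or>
     (\<exists>g. g holomorphic_on \<Omega> \<and> (\<forall>s\<in>\<Omega>. f s = Some (g s)))"

end

theory Submission
  imports Defs "HOL-Real_Asymp.Real_Asymp"
begin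

text \<open>Both directions are about ordinary uniform convergence once the chordal metric has been dealt with.

\<^bold>\<open>Density.\<close> The constants \<open>k\<close> converge to \<open>\<infinity>\<close>. For holomorphic \<open>f\<close>, Runge's theorem approximates
\<open>f\<close> by a polynomial in \<open>s\<close> plus polynomials in \<open>1 / (s - z)\<close> with finitely many finite \<open>z\<close> in \<open>A\<close>, so it
remains to approximate a polynomial by Dirichlet polynomials on bounded sets
(\<open>polynomial_approximable_by_dirichlet_polynomials\<close>). Products of Dirichlet polynomials are Dirichlet
polynomials, so the identity function is enough. Now \<open>- s\<close> is the value at \<open>0\<close> of the entire function
\<open>\<lambda> \<mapsto> (exp (- \<lambda> s) - 1) / \<lambda>\<close>, and interpolating this function at the nodes \<open>ln 2, \<dots>, ln N\<close> gives a
linear combination of the functions \<open>1 - n powr (- s)\<close> whose coefficients do not depend on \<open>s\<close>. The point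
is that there are exponentially many nodes in an interval of given length: \<open>N - 1\<close> nodes of modulus at
most \<open>ln N\<close>. With a circle of radius \<open>N\<close> the error estimate \<open>interpolation_error\<close> becomes
\<open>(4 ln N / (N - ln N)) ^ (N - 1)\<close> times \<open>2 exp (N r)\<close> for \<open>\<bar>s\<bar> \<le> r\<close>, which tends to \<open>0\<close>.

Runge's theorem is proved in its classical form. Cauchy's formula on a fine square grid
(\<open>Cauchy_grid_representation\<close>) writes \<open>f\<close> on a compact set \<open>K\<close> as a sum of Cauchy integrals along
segments off \<open>K\<close>; Riemann sums turn these into combinations of \<open>1 / (s - w)\<close> with \<open>w\<close> off \<open>K\<close>
(\<open>cauchy_segment_approximable\<close>); and the geometric series moves the pole \<open>w\<close> inside its component of the
complement of \<open>K\<close>, either to a prescribed point or to \<open>\<infinity>\<close> (\<open>pole_pushing\<close>). The hypothesis on \<open>A\<close> concerns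
the components of \<open>- \<Omega>\<close>, so the compact sets are taken from an exhaustion of \<open>\<Omega>\<close> for which every bounded
complementary component contains one of those.

\<^bold>\<open>Converse.\<close> The distance to \<open>\<infinity>\<close> is \<open>1\<close>-Lipschitz for \<open>\<chi>\<close>, so a chordal limit \<open>f\<close> of holomorphic functions
has a continuous distance to \<open>\<infinity>\<close>, and the set where \<open>f\<close> is finite is open. Where \<open>f\<close> is finite, chordal
convergence is locally ordinary uniform convergence and \<open>f\<close> is holomorphic
(\<open>uniform_limit_where_finite\<close>). Near a point where \<open>f = \<infinity>\<close> the reciprocals of the approximating functions
are holomorphic, have no zeros, and converge uniformly to the reciprocal of \<open>f\<close>, which has a zero; by
Hurwitz it vanishes identically, so the set where \<open>f = \<infinity>\<close> is open as well
(\<open>chordal_limit_infinite_nearby\<close>). Connectedness of \<open>\<Omega>\<close> leaves only one of the two sets.\<close>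

section \<open>Uniform approximation by a family of functions\<close>

definition approximable_on :: "'a set \<Rightarrow> ('a \<Rightarrow> complex) set \<Rightarrow> ('a \<Rightarrow> complex) \<Rightarrow> bool" where
  "approximable_on K F u \<longleftrightarrow> (\<forall>\<epsilon>>0. \<exists>h\<in>F. \<forall>s\<in>K. cmod (h s - u s) < \<epsilon>)"

definition linear_family :: "('a \<Rightarrow> complex) set \<Rightarrow> bool" where
  "linear_family F \<longleftrightarrow>
     (\<lambda>s. 0) \<in> F \<and> (\<forall>g\<in>F. \<forall>h\<in>F. (\<lambda>s. g s + h s) \<in> F) \<and> (\<forall>c. \<forall>h\<in>F. (\<lambda>s. c * h s) \<in> F)"

text \<open>Products of uniform approximations are controlled only when the factors are bounded, hence boundedness
is made part of the notion.\<close>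

definition bounded_algebra_on :: "'a set \<Rightarrow> ('a \<Rightarrow> complex) set \<Rightarrow> bool" where
  "bounded_algebra_on K F \<longleftrightarrow>
     linear_family F \<and> (\<lambda>s. 1) \<in> F \<and> (\<forall>g\<in>F. \<forall>h\<in>F. (\<lambda>s. g s * h s) \<in> F) \<and>
     (\<forall>h\<in>F. bounded (h ` K))"

definition polynomials_in :: "('a \<Rightarrow> complex) \<Rightarrow> ('a \<Rightarrow> complex) set" where
  "polynomials_in v = range (\<lambda>p s. poly p (v s))"

lemma linear_family_add: "linear_family F \<Longrightarrow> g \<in> F \<Longrightarrow> h \<in> F \<Longrightarrow> (\<lambda>s. g s + h s) \<in> F"
  by (simp add: linear_family_def)

lemma linear_family_scale: "linear_family F \<Longrightarrow> h \<in> F \<Longrightarrow> (\<lambda>s. c * h s) \<in> F"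
  by (simp add: linear_family_def)

lemma bounded_algebra_linear: "bounded_algebra_on K F \<Longrightarrow> linear_family F"
  by (simp add: bounded_algebra_on_def)

lemma bounded_algebra_mult:
  "bounded_algebra_on K F \<Longrightarrow> g \<in> F \<Longrightarrow> h \<in> F \<Longrightarrow> (\<lambda>s. g s * h s) \<in> F"
  by (simp add: bounded_algebra_on_def)

lemma approximable_onI:
  assumes "\<And>\<epsilon>. \<epsilon> > 0 \<Longrightarrow> \<exists>h. h \<in> F \<and> (\<forall>s\<in>K. cmod (h s - u s) < \<epsilon>)"
  shows "approximable_on K F u"
  using assms unfolding approximable_on_def Bex_def by simp

lemma approximable_onD:
  assumes "approximable_on K F u" "\<epsilon> > 0"
  obtains h where "h \<in> F" "\<And>s. s \<in> K \<Longrightarrow> cmod (h s - u s) < \<epsilon>"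
  using assms unfolding approximable_on_def by meson

lemma approximable_on_member: "u \<in> F \<Longrightarrow> approximable_on K F u"
  unfolding approximable_on_def by force

lemma approximable_on_cong:
  assumes "approximable_on K F u" "\<And>s. s \<in> K \<Longrightarrow> u s = v s"
  shows "approximable_on K F v"
  using assms unfolding approximable_on_def by simp

text \<open>Together with the next lemma this makes the approximable functions a uniformly closed set, so that all
approximations below can be carried out in stages.\<close>

lemma approximable_on_trans:
  assumes u: "approximable_on K G u" and G: "\<And>g. g \<in> G \<Longrightarrow> approximable_on K F g"
  shows "approximable_on K F u"
proof (rule approximable_onI)
  fix e :: real assume "e > 0"
  then obtain g where g: "g \<in> G" "\<And>s. s \<in> K \<Longrightarrow> cmod (g s - u s) < e/2"
    using approximable_onD[OF u, of "e/2"] by (metis half_gt_zero)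
  obtain h where h: "h \<in> F" "\<And>s. s \<in> K \<Longrightarrow> cmod (h s - g s) < e/2"
    using approximable_onD[OF G[OF g(1)], of "e/2"] \<open>e > 0\<close> by (metis half_gt_zero)
  have "cmod (h s - u s) < e" if "s \<in> K" for s
    using norm_triangle_ineq[of "h s - g s" "g s - u s"] g(2)[OF that] h(2)[OF that] by simp
  with h(1) show "\<exists>h. h \<in> F \<and> (\<forall>s\<in>K. cmod (h s - u s) < e)" by (intro exI conjI ballI)
qed

lemma approximable_on_closed:
  assumes "\<And>\<epsilon>. \<epsilon> > 0 \<Longrightarrow> \<exists>v. approximable_on K F v \<and> (\<forall>s\<in>K. cmod (v s - u s) < \<epsilon>)"
  shows "approximable_on K F u"
  by (rule approximable_on_trans[where G = "{v. approximable_on K F v}"])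
     (use assms in \<open>auto simp: approximable_on_def[of K "{v. approximable_on K F v}"]\<close>)

lemma approximable_on_add:
  assumes F: "linear_family F" and u: "approximable_on K F u" and v: "approximable_on K F v"
  shows "approximable_on K F (\<lambda>s. u s + v s)"
proof (rule approximable_onI)
  fix e :: real assume "e > 0"
  then obtain g where g: "g \<in> F" "\<And>s. s \<in> K \<Longrightarrow> cmod (g s - u s) < e/2"
    using approximable_onD[OF u, of "e/2"] by (metis half_gt_zero)
  obtain h where h: "h \<in> F" "\<And>s. s \<in> K \<Longrightarrow> cmod (h s - v s) < e/2"
    using approximable_onD[OF v, of "e/2"] \<open>e > 0\<close> by (metis half_gt_zero)
  have "cmod (g s + h s - (u s + v s)) < e" if "s \<in> K" for s
    using norm_triangle_ineq[of "g s - u s" "h s - v s"] g(2)[OF that] h(2)[OF that]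
    by (simp add: algebra_simps)
  moreover have "(\<lambda>s. g s + h s) \<in> F" using F g(1) h(1) by (rule linear_family_add)
  ultimately show "\<exists>h. h \<in> F \<and> (\<forall>s\<in>K. cmod (h s - (u s + v s)) < e)" by (intro exI conjI ballI)
qed

lemma approximable_on_scale:
  assumes F: "linear_family F" and u: "approximable_on K F u"
  shows "approximable_on K F (\<lambda>s. c * u s)"
proof (rule approximable_onI)
  fix e :: real assume e: "e > 0"
  have "e / (cmod c + 1) > 0" using e by (simp add: add_nonneg_pos)
  from approximable_onD[OF u this] obtain g
    where g: "g \<in> F" "\<And>s. s \<in> K \<Longrightarrow> cmod (g s - u s) < e / (cmod c + 1)" by blast
  have "cmod (c * g s - c * u s) < e" if "s \<in> K" for s
  proof -
    have "cmod (c * g s - c * u s) = cmod c * cmod (g s - u s)"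
      by (metis norm_mult right_diff_distrib)
    also have "\<dots> \<le> cmod c * (e / (cmod c + 1))"
      using g(2)[OF that] by (intro mult_left_mono) auto
    also have "\<dots> < e" using e by (simp add: field_simps add_pos_nonneg)
    finally show ?thesis .
  qed
  moreover have "(\<lambda>s. c * g s) \<in> F" using F g(1) by (rule linear_family_scale)
  ultimately show "\<exists>h. h \<in> F \<and> (\<forall>s\<in>K. cmod (h s - c * u s) < e)" by (intro exI conjI ballI)
qed

lemma approximable_on_sum:
  assumes F: "linear_family F" and u: "\<And>i. i \<in> I \<Longrightarrow> approximable_on K F (u i)"
  shows "approximable_on K F (\<lambda>s. \<Sum>i\<in>I. u i s)"
  using u
proof (induction I rule: infinite_finite_induct)
  case (insert i I)
  then show ?case using approximable_on_add[OF F] by simp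
qed (use F in \<open>simp_all add: approximable_on_member linear_family_def\<close>)

lemma approximable_on_mult:
  assumes F: "bounded_algebra_on K F"
    and u: "approximable_on K F u" and v: "approximable_on K F v"
  shows "approximable_on K F (\<lambda>s. u s * v s)"
proof (rule approximable_onI)
  fix e :: real assume e: "e > 0"
  have bound: "\<exists>M>0. \<forall>s\<in>K. cmod (w s) \<le> M" if w: "approximable_on K F w" for w
  proof -
    obtain h where h: "h \<in> F" "\<And>s. s \<in> K \<Longrightarrow> cmod (h s - w s) < 1"
      using approximable_onD[OF w, of 1] by auto
    obtain M where M: "M > 0" "\<And>s. s \<in> K \<Longrightarrow> cmod (h s) \<le> M"
      using F h(1) unfolding bounded_algebra_on_def bounded_pos by auto
    have "cmod (w s) \<le> M + 1" if "s \<in> K" for s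
      using norm_triangle_ineq2[of "w s" "h s"] h(2)[OF that] M(2)[OF that]
      by (simp add: norm_minus_commute)
    then show ?thesis using M(1) by (intro exI[of _ "M+1"]) auto
  qed
  obtain M where M: "M > 0" "\<And>s. s \<in> K \<Longrightarrow> cmod (u s) \<le> M" using bound[OF u] by blast
  obtain N where N: "N > 0" "\<And>s. s \<in> K \<Longrightarrow> cmod (v s) \<le> N" using bound[OF v] by blast
  define d where "d = min 1 (e / (2 * (M + N + 1)))"
  have d: "d > 0" "d \<le> 1" "d * (M + N + 1) < e"
  proof -
    show "d > 0" "d \<le> 1" using e M N by (auto simp: d_def)
    have "d * (M + N + 1) \<le> e / (2 * (M + N + 1)) * (M + N + 1)"
      using M N by (intro mult_right_mono) (auto simp: d_def)
    also have "\<dots> = e / 2" using M N by (simp add: field_simps)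
    finally show "d * (M + N + 1) < e" using e by simp
  qed
  obtain g where g: "g \<in> F" "\<And>s. s \<in> K \<Longrightarrow> cmod (g s - u s) < d"
    using approximable_onD[OF u d(1)] by blast
  obtain h where h: "h \<in> F" "\<And>s. s \<in> K \<Longrightarrow> cmod (h s - v s) < d"
    using approximable_onD[OF v d(1)] by blast
  have "cmod (g s * h s - u s * v s) < e" if s: "s \<in> K" for s
  proof -
    have hs: "cmod (h s) \<le> N + 1"
      using norm_triangle_ineq2[of "h s" "v s"] h(2)[OF s] N(2)[OF s] d(2) by linarith
    have "g s * h s - u s * v s = (g s - u s) * h s + u s * (h s - v s)"
      by (simp add: algebra_simps)
    then have "cmod (g s * h s - u s * v s) \<le> cmod (g s - u s) * cmod (h s) + cmod (u s) * cmod (h s - v s)"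
      by (metis norm_mult norm_triangle_ineq)
    also have "\<dots> \<le> d * (N + 1) + M * d"
      using g(2)[OF s] h(2)[OF s] M(2)[OF s] hs d(1) M(1)
      by (intro add_mono mult_mono) auto
    also have "\<dots> < e" using d(3) by (simp add: algebra_simps)
    finally show ?thesis .
  qed
  moreover have "(\<lambda>s. g s * h s) \<in> F" using F g(1) h(1) by (rule bounded_algebra_mult)
  ultimately show "\<exists>h. h \<in> F \<and> (\<forall>s\<in>K. cmod (h s - u s * v s) < e)" by (intro exI conjI ballI)
qed

lemma approximable_on_const:
  assumes "bounded_algebra_on K F"
  shows "approximable_on K F (\<lambda>s. c)"
  using approximable_on_scale[OF _ approximable_on_member[of "\<lambda>s. 1" F K], of c] assms
  unfolding bounded_algebra_on_def by simp

lemma approximable_on_poly: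
  assumes F: "bounded_algebra_on K F" and u: "approximable_on K F u"
  shows "approximable_on K F (\<lambda>s. poly p (u s))"
proof (induction p)
  case 0
  show ?case using approximable_on_const[OF F, of 0] by simp
next
  case (pCons a p)
  from approximable_on_add[OF bounded_algebra_linear[OF F] approximable_on_const[OF F] approximable_on_mult[OF F u pCons(2)]]
  show ?case by simp
qed

lemma bounded_algebra_polynomials_in:
  assumes "bounded (v ` K)"
  shows "bounded_algebra_on K (polynomials_in v)"
proof -
  have "bounded ((\<lambda>s. poly p (v s)) ` K)" for p
  proof -
    have "compact (closure (v ` K))" using assms by (simp add: compact_closure)
    then have "bounded (poly p ` closure (v ` K))"
      by (intro compact_imp_bounded compact_continuous_image) (auto intro!: continuous_intros)
    moreover have "(\<lambda>s. poly p (v s)) ` K \<subseteq> poly p ` closure (v ` K)"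
      using closure_subset by fastforce
    ultimately show ?thesis by (rule bounded_subset)
  qed
  moreover have "\<exists>r. (\<lambda>s. poly p (v s) + poly q (v s)) = (\<lambda>s. poly r (v s))" for p q
    by (rule exI[of _ "p + q"]) simp
  moreover have "\<exists>r. (\<lambda>s. poly p (v s) * poly q (v s)) = (\<lambda>s. poly r (v s))" for p q
    by (rule exI[of _ "p * q"]) simp
  moreover have "\<exists>r. (\<lambda>s. c * poly p (v s)) = (\<lambda>s. poly r (v s))" for p c
    by (rule exI[of _ "smult c p"]) simp
  moreover have "\<exists>r. (\<lambda>s. c) = (\<lambda>s. poly r (v s))" for c
    by (rule exI[of _ "[:c:]"]) simp
  ultimately show ?thesis
    unfolding bounded_algebra_on_def linear_family_def polynomials_in_def image_iff by auto
qed

section \<open>Dirichlet polynomials approximate polynomials\<close>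

lemma dirichlet_polynomialI:
  "dirichlet_polynomial (\<lambda>s. \<Sum>n=1..M. a n * (1 / of_nat n powr s))"
  unfolding dirichlet_polynomial_def by blast

lemma dirichlet_polynomialE:
  assumes "dirichlet_polynomial P"
  obtains M a where "P = (\<lambda>s. \<Sum>n=1..M. a n * (1 / of_nat n powr s))"
  using assms unfolding dirichlet_polynomial_def by blast

lemma dirichlet_polynomial_monomial:
  assumes "n \<ge> 1"
  shows "dirichlet_polynomial (\<lambda>s. c * (1 / of_nat n powr s))"
proof -
  have "(\<Sum>m=1..n. (if m = n then c else 0) * (1 / of_nat m powr s)) = c * (1 / of_nat n powr s)" for s :: complex
    using assms by (simp add: if_distrib[of "\<lambda>x. x / _"] cong: if_cong)
  then show ?thesis using dirichlet_polynomialI[where M = n and a = "\<lambda>m. if m = n then c else 0"] by simp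
qed

lemma dirichlet_polynomial_add:
  assumes "dirichlet_polynomial P" "dirichlet_polynomial Q"
  shows "dirichlet_polynomial (\<lambda>s. P s + Q s)"
proof -
  have pad: "(\<Sum>n=1..M. a n * (1 / of_nat n powr s)) =
      (\<Sum>n=1..max M N. (if n \<le> M then a n else 0) * (1 / of_nat n powr s))"
    for M N :: nat and a and s :: complex
    by (rule sum.mono_neutral_cong_left) auto
  obtain M a where P: "P = (\<lambda>s. \<Sum>n=1..M. a n * (1 / of_nat n powr s))"
    by (rule dirichlet_polynomialE[OF assms(1)])
  obtain N b where Q: "Q = (\<lambda>s. \<Sum>n=1..N. b n * (1 / of_nat n powr s))"
    by (rule dirichlet_polynomialE[OF assms(2)])
  have "P s + Q s = (\<Sum>n=1..max M N. ((if n \<le> M then a n else 0) + (if n \<le> N then b n else 0))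
      * (1 / of_nat n powr s))" for s
    unfolding P Q distrib_right sum.distrib using pad[of a s M N] pad[of b s N M]
    by (simp add: max.commute)
  then show ?thesis by (simp only: dirichlet_polynomialI)
qed

lemma dirichlet_polynomial_const: "dirichlet_polynomial (\<lambda>s. c)"
  using dirichlet_polynomial_monomial[of 1 c] by simp

lemma dirichlet_polynomial_sum:
  assumes "\<And>i. i \<in> I \<Longrightarrow> dirichlet_polynomial (P i)"
  shows "dirichlet_polynomial (\<lambda>s. \<Sum>i\<in>I. P i s)"
  using assms
  by (induction I rule: infinite_finite_induct)
     (auto intro: dirichlet_polynomial_const dirichlet_polynomial_add)

lemma of_nat_powr_eq_exp:
  fixes s :: complex
  assumes "n \<ge> 1"
  shows "1 / of_nat n powr s = exp (- (of_real (ln (real n)) * s))"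
proof -
  have "Ln (of_nat n :: complex) = of_real (ln (real n))" using assms by (simp add: Ln_of_nat)
  moreover have "of_nat n powr s = exp (s * Ln (of_nat n))" using assms by (simp add: powr_def)
  ultimately have "of_nat n powr s = exp (s * of_real (ln (real n)))" by (simp only:)
  then show ?thesis by (simp only: exp_minus divide_inverse mult.commute[of s] mult_1_left)
qed

lemma dirichlet_polynomial_mult:
  assumes "dirichlet_polynomial P" "dirichlet_polynomial Q"
  shows "dirichlet_polynomial (\<lambda>s. P s * Q s)"
proof -
  obtain M a where P: "P = (\<lambda>s. \<Sum>m=1..M. a m * (1 / of_nat m powr s))"
    by (rule dirichlet_polynomialE[OF assms(1)])
  obtain N b where Q: "Q = (\<lambda>s. \<Sum>n=1..N. b n * (1 / of_nat n powr s))"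
    by (rule dirichlet_polynomialE[OF assms(2)])
  have "a m * (1 / of_nat m powr s) * (b n * (1 / of_nat n powr s)) =
      a m * b n * (1 / of_nat (m * n) powr s)" if "m \<ge> 1" "n \<ge> 1" for m n and s :: complex
    using that unfolding of_nat_powr_eq_exp[OF that(1)] of_nat_powr_eq_exp[OF that(2)]
    by (subst of_nat_powr_eq_exp) (auto simp: ln_mult algebra_simps exp_add exp_diff exp_minus field_simps)
  then have "P s * Q s = (\<Sum>m=1..M. \<Sum>n=1..N. a m * b n * (1 / of_nat (m * n) powr s))" for s
    unfolding P Q sum_product by (intro sum.cong) auto
  then show ?thesis
    by (simp only:) (intro dirichlet_polynomial_sum dirichlet_polynomial_monomial, auto simp: Suc_le_eq)
qed

lemma dirichlet_polynomial_holomorphic: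
  assumes "dirichlet_polynomial P"
  shows "P holomorphic_on S"
proof -
  obtain M a where P: "P = (\<lambda>s. \<Sum>m=1..M. a m * (1 / of_nat m powr s))"
    by (rule dirichlet_polynomialE[OF assms])
  have "P = (\<lambda>s. \<Sum>m=1..M. a m * exp (- (of_real (ln (real m)) * s)))"
    unfolding P by (intro ext sum.cong refl) (metis atLeastAtMost_iff of_nat_powr_eq_exp)
  then show ?thesis by (auto intro!: holomorphic_intros)
qed

lemma bounded_algebra_dirichlet_polynomials:
  assumes "bounded K"
  shows "bounded_algebra_on K {P. dirichlet_polynomial P}"
proof -
  have "bounded (P ` K)" if "dirichlet_polynomial P" for P
  proof -
    have "continuous_on (closure K) P"
      using dirichlet_polynomial_holomorphic[OF that] holomorphic_on_imp_continuous_on by blast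
    then have "bounded (P ` closure K)"
      using assms by (intro compact_imp_bounded compact_continuous_image) (auto simp: compact_closure)
    then show ?thesis by (rule bounded_subset) (auto simp: closure_subset[THEN subsetD])
  qed
  then show ?thesis
    unfolding bounded_algebra_on_def linear_family_def
    by (auto intro: dirichlet_polynomial_const dirichlet_polynomial_add dirichlet_polynomial_mult)
qed

definition difference_quotient :: "(complex \<Rightarrow> complex) \<Rightarrow> complex \<Rightarrow> complex \<Rightarrow> complex" where
  "difference_quotient f a = (\<lambda>z. if z = a then deriv f a else (f z - f a) / (z - a))"

lemma difference_quotient_holomorphic:
  "f holomorphic_on UNIV \<Longrightarrow> difference_quotient f a holomorphic_on UNIV"
  unfolding difference_quotient_def by (rule pole_lemma_open) auto

text \<open>This keeps the bounds of the interpolation argument on a single circle, although the nodes lie inside it.\<close>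

lemma maximum_modulus_circle:
  assumes f: "f holomorphic_on UNIV" and B: "\<And>z. cmod z = \<rho> \<Longrightarrow> cmod (f z) \<le> B" and "cmod z < \<rho>"
  shows "cmod (f z) \<le> B"
proof (rule maximum_modulus_frontier[of f "ball 0 \<rho>"])
  show "f holomorphic_on interior (ball 0 \<rho>)" using f holomorphic_on_subset by blast
  show "continuous_on (closure (ball 0 \<rho>)) f"
    using f holomorphic_on_imp_continuous_on continuous_on_subset by blast
  have "\<rho> > 0" using assms(3) norm_ge_zero order_le_less_trans by blast
  then show "cmod (f z) \<le> B" if "z \<in> frontier (ball 0 \<rho>)" for z
    using that B by (simp add: frontier_ball)
qed (use assms in auto)

text \<open>The weights \<open>c\<close> are those of Lagrange interpolation at the nodes \<open>S\<close>, evaluated at \<open>x\<close>. Newton's scheme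
gives them together with the error. Splitting off a node \<open>a\<close> replaces \<open>f\<close> by its difference quotient \<open>g\<close>, where
\<open>f z = f a + (z - a) g z\<close>. On the circle of radius \<open>\<rho>\<close> this multiplies the bound by at most \<open>2 / (\<rho> - R)\<close>,
and the factor \<open>x - a\<close> contributes at most \<open>2 R\<close>; hence one factor \<open>4 R / (\<rho> - R)\<close> for each node. That
the weights are the same for all \<open>f\<close> is what allows \<open>f\<close> to depend on a further parameter.\<close>

lemma interpolation_error:
  assumes "finite S" "S \<subseteq> cball 0 R" "cmod x \<le> R" "R < \<rho>"
  obtains c where "\<And>f B. f holomorphic_on UNIV \<Longrightarrow> (\<And>z. cmod z = \<rho> \<Longrightarrow> cmod (f z) \<le> B) \<Longrightarrow>
      cmod (f x - (\<Sum>a\<in>S. c a * f a)) \<le> (4 * R / (\<rho> - R)) ^ card S * B"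
proof -
  have "\<exists>c. \<forall>f B. f holomorphic_on UNIV \<longrightarrow> (\<forall>z. cmod z = \<rho> \<longrightarrow> cmod (f z) \<le> B) \<longrightarrow>
      cmod (f x - (\<Sum>a\<in>S. c a * f a)) \<le> (4 * R / (\<rho> - R)) ^ card S * B"
    using assms(1,2)
  proof (induction S rule: finite_induct)
    case empty
    show ?case using maximum_modulus_circle[of _ \<rho> _ x] assms(3,4) by auto
  next
    case (insert a S)
    then obtain c where c: "\<And>f B. f holomorphic_on UNIV \<Longrightarrow> (\<And>z. cmod z = \<rho> \<Longrightarrow> cmod (f z) \<le> B) \<Longrightarrow>
      cmod (f x - (\<Sum>a\<in>S. c a * f a)) \<le> (4 * R / (\<rho> - R)) ^ card S * B" by auto
    have aR: "cmod a \<le> R" using insert by auto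
    define c' where "c' b = (x - a) * c b / (b - a)" for b
    define e where "e = (\<lambda>b. if b = a then 1 - (\<Sum>b\<in>S. c' b) else c' b)"
    show ?case
    proof (intro exI[of _ e] allI impI)
      fix f B assume f: "f holomorphic_on UNIV" and B: "\<forall>z. cmod z = \<rho> \<longrightarrow> cmod (f z) \<le> B"
      let ?g = "difference_quotient f a"
      have "cmod (?g z) \<le> 2 * B / (\<rho> - R)" if z: "cmod z = \<rho>" for z
      proof -
        have "\<rho> - R \<le> cmod (z - a)" using norm_triangle_ineq2[of z a] z aR by linarith
        moreover have "cmod (f z - f a) \<le> 2 * B"
          using norm_triangle_ineq4[of "f z" "f a"] B z maximum_modulus_circle[OF f, of \<rho> B a] aR assms(4)
          by fastforce
        ultimately have "cmod (f z - f a) / cmod (z - a) \<le> 2 * B / (\<rho> - R)"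
          using assms(4) norm_ge_zero[of "f z - f a"] by (intro frac_le) linarith+
        moreover have "z \<noteq> a" using z aR assms(4) by auto
        ultimately show ?thesis by (simp add: difference_quotient_def norm_divide)
      qed
      from c[OF difference_quotient_holomorphic[OF f] this]
      have g: "cmod (?g x - (\<Sum>b\<in>S. c b * ?g b)) \<le> (4 * R / (\<rho> - R)) ^ card S * (2 * B / (\<rho> - R))" .
      have nodes: "(x - a) * (c b * ?g b) = c' b * f b - c' b * f a" if "b \<in> S" for b
        using that insert.hyps unfolding difference_quotient_def c'_def by (auto simp: field_simps)
      have "(\<Sum>b\<in>S. e b * f b) = (\<Sum>b\<in>S. c' b * f b)"
        using insert.hyps by (intro sum.cong) (auto simp: e_def)
      moreover have "e a * f a = f a - (\<Sum>b\<in>S. c' b * f a)"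
        by (simp add: e_def left_diff_distrib sum_distrib_right)
      ultimately have "f x - (\<Sum>b\<in>insert a S. e b * f b) =
          f x - f a - (\<Sum>b\<in>S. c' b * f b - c' b * f a)"
        using insert.hyps by (simp add: sum_subtractf)
      also have "\<dots> = (x - a) * ?g x - (x - a) * (\<Sum>b\<in>S. c b * ?g b)"
        using nodes by (simp add: sum_distrib_left difference_quotient_def)
      finally have "cmod (f x - (\<Sum>b\<in>insert a S. e b * f b)) =
          cmod (x - a) * cmod (?g x - (\<Sum>b\<in>S. c b * ?g b))"
        by (simp only: right_diff_distrib[symmetric] norm_mult)
      also have "\<dots> \<le> (2 * R) * ((4 * R / (\<rho> - R)) ^ card S * (2 * B / (\<rho> - R)))"
        using norm_triangle_ineq4[of x a] assms(3) aR g order_trans[OF norm_ge_zero aR]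
        by (intro mult_mono) auto
      also have "\<dots> = (4 * R / (\<rho> - R)) ^ card (insert a S) * B"
        using insert.hyps by simp
      finally show "cmod (f x - (\<Sum>b\<in>insert a S. e b * f b)) \<le> (4 * R / (\<rho> - R)) ^ card (insert a S) * B" .
    qed
  qed
  then show ?thesis using that by blast
qed

text \<open>The function \<open>f\<close> of the proof depends on \<open>s\<close>; its difference quotient at \<open>0\<close> takes the value \<open>- s\<close> there and
\<open>(n powr (- s) - 1) / ln n\<close> at the node \<open>ln n\<close>. The node \<open>ln 1 = 0\<close> is left out because it is the point of
evaluation. The radius \<open>N\<close> of the circle is a compromise: it must dominate \<open>ln N\<close>, to
make the base of the power small, and stay linear in \<open>N\<close>, so that the power outweighs \<open>exp (N r)\<close>.\<close>

lemma identity_approximable_by_dirichlet_polynomials: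
  assumes "bounded K"
  shows "approximable_on K {P. dirichlet_polynomial P} (\<lambda>s. s)"
proof (rule approximable_onI)
  fix e :: real assume "e > 0"
  obtain r where r: "r > 0" "\<And>s. s \<in> K \<Longrightarrow> cmod s \<le> r"
    using assms unfolding bounded_pos by auto
  have "((\<lambda>N::nat. (4 * ln (real N) / (real N - ln (real N))) ^ (N - 1) * (2 * exp (real N * r)))
          \<longlongrightarrow> 0) at_top"
    using r(1) by real_asymp
  then have "\<forall>\<^sub>F N::nat in at_top. (4 * ln (real N) / (real N - ln (real N))) ^ (N - 1) * (2 * exp (real N * r)) < e"
    using \<open>e > 0\<close> by (rule order_tendstoD)
  then obtain N :: nat where N: "N \<ge> 2"
    "(4 * ln (real N) / (real N - ln (real N))) ^ (N - 1) * (2 * exp (real N * r)) < e"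
    by (metis (no_types, lifting) eventually_at_top_linorder nat_le_linear)
  define node where "node n = complex_of_real (ln (real n))" for n
  have inj: "inj_on node {2..N}" by (auto simp: inj_on_def node_def)
  have sub: "node ` {2..N} \<subseteq> cball 0 (ln (real N))" by (auto simp: node_def)
  obtain c where c: "\<And>f B. f holomorphic_on UNIV \<Longrightarrow> (\<And>z. cmod z = real N \<Longrightarrow> cmod (f z) \<le> B) \<Longrightarrow>
      cmod (f 0 - (\<Sum>a\<in>node ` {2..N}. c a * f a)) \<le>
        (4 * ln (real N) / (real N - ln (real N))) ^ card (node ` {2..N}) * B"
    using interpolation_error[OF _ sub, of 0 "real N"] N(1) ln_less_self[of "real N"] by force
  have card: "card (node ` {2..N}) = N - 1" using card_image[OF inj] by simp
  let ?D = "\<lambda>s. \<Sum>n=2..N. c (node n) / node n * (1 - 1 / of_nat n powr s)"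
  have "cmod (?D s - s) < e" if s: "s \<in> K" for s
  proof -
    define f where "f z = exp (- (z * s))" for z :: complex
    have f: "f holomorphic_on UNIV" unfolding f_def by (intro holomorphic_intros)
    let ?g = "difference_quotient f 0"
    have f0: "f 0 = 1" by (simp add: f_def)
    have "deriv f 0 = - s"
      unfolding f_def by (rule DERIV_imp_deriv) (auto intro!: derivative_eq_intros)
    then have g0: "?g 0 = - s" by (simp add: difference_quotient_def)
    have gn: "c (node n) * ?g (node n) = - (c (node n) / node n * (1 - 1 / of_nat n powr s))"
      if "n \<in> {2..N}" for n
    proof -
      have "n \<ge> 1" "node n \<noteq> 0" using that by (auto simp: node_def)
      then show ?thesis
        unfolding difference_quotient_def f_def of_nat_powr_eq_exp[OF \<open>n \<ge> 1\<close>] node_def[symmetric]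
        by (simp add: field_simps)
    qed
    have "cmod (?g z) \<le> 2 * exp (real N * r)" if z: "cmod z = real N" for z
    proof -
      have "cmod (f z) \<le> exp (cmod (- (z * s)))" unfolding f_def by (rule norm_exp)
      also have "\<dots> \<le> exp (real N * r)" using r(2)[OF s] z by (simp add: norm_mult mult_left_mono)
      finally have "cmod (f z - f 0) \<le> exp (real N * r) + 1"
        using norm_triangle_ineq4[of "f z" "f 0"] f0 by simp
      also have "\<dots> \<le> 2 * exp (real N * r)" using r(1) by simp
      finally have "cmod (f z - f 0) / cmod z \<le> 2 * exp (real N * r) / 1"
        using z N(1) by (intro frac_le) auto
      then show ?thesis using z N(1) by (auto simp: difference_quotient_def norm_divide)
    qed
    from c[OF difference_quotient_holomorphic[OF f] this]
    have "cmod (?g 0 - (\<Sum>a\<in>node ` {2..N}. c a * ?g a)) < e" using N(2) card by simp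
    also have "(\<Sum>a\<in>node ` {2..N}. c a * ?g a) = - ?D s"
      unfolding sum.reindex[OF inj] o_def using gn by (simp add: sum_negf)
    finally show ?thesis by (simp add: g0)
  qed
  moreover have "dirichlet_polynomial ?D"
  proof (rule dirichlet_polynomial_sum)
    fix n assume n: "n \<in> {2..N}"
    have "dirichlet_polynomial (\<lambda>s. c (node n) / node n + - (c (node n) / node n) * (1 / of_nat n powr s))"
      using n by (intro dirichlet_polynomial_add dirichlet_polynomial_const dirichlet_polynomial_monomial) auto
    then show "dirichlet_polynomial (\<lambda>s. c (node n) / node n * (1 - 1 / of_nat n powr s))"
      by (simp add: algebra_simps)
  qed
  ultimately show "\<exists>h. h \<in> {P. dirichlet_polynomial P} \<and> (\<forall>s\<in>K. cmod (h s - s) < e)"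
    by (intro exI[of _ ?D]) simp
qed

lemma polynomial_approximable_by_dirichlet_polynomials:
  assumes "bounded K"
  shows "approximable_on K {P. dirichlet_polynomial P} (poly p)"
  using approximable_on_poly[OF bounded_algebra_dirichlet_polynomials[OF assms]
      identity_approximable_by_dirichlet_polynomials[OF assms]] by (simp add: eta_contract_eq)

section \<open>Moving poles\<close>

text \<open>The partial sums of the geometric series are polynomials in \<open>v\<close>. All approximations by functions with
other poles come from here.\<close>

lemma geometric_series_approximable:
  fixes v :: "'a \<Rightarrow> complex"
  assumes q: "0 \<le> q" "q < 1" "\<And>s. s \<in> K \<Longrightarrow> cmod (c * v s) \<le> q"
  shows "approximable_on K (polynomials_in v) (\<lambda>s. 1 / (1 - c * v s))"
proof (rule approximable_onI)
  fix e :: real assume e: "e > 0"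
  have "(\<lambda>n. q ^ n / (1 - q)) \<longlonglongrightarrow> 0"
    using q by (auto intro!: tendsto_eq_intros LIMSEQ_power_zero)
  then obtain n where n: "q ^ n / (1 - q) < e"
    using order_tendstoD(2)[OF _ e] by (metis (no_types, lifting) eventually_sequentially order_refl)
  define h where "h s = poly (\<Sum>k<n. monom (c ^ k) k) (v s)" for s
  have "cmod (h s - 1 / (1 - c * v s)) < e" if s: "s \<in> K" for s
  proof -
    define x where "x = c * v s"
    have x: "cmod x \<le> q" using q(3)[OF s] by (simp add: x_def)
    have x1: "1 - q \<le> cmod (1 - x)" using norm_triangle_ineq2[of 1 x] x by simp
    then have "x \<noteq> 1" using q(2) by auto
    have "h s = (\<Sum>k<n. x ^ k)" by (simp add: h_def x_def poly_sum poly_monom power_mult_distrib)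
    also have "\<dots> = (1 - x ^ n) / (1 - x)"
      using \<open>x \<noteq> 1\<close> by (simp add: one_diff_power_eq)
    finally have "h s - 1 / (1 - x) = - (x ^ n) / (1 - x)"
      by (simp add: diff_divide_distrib)
    then have "cmod (h s - 1 / (1 - x)) = cmod x ^ n / cmod (1 - x)"
      by (simp add: norm_divide norm_power)
    also have "\<dots> \<le> q ^ n / (1 - q)"
      using x x1 q by (intro frac_le power_mono) auto
    also have "\<dots> < e" by (rule n)
    finally show ?thesis by (simp add: x_def)
  qed
  moreover have "h \<in> polynomials_in v" unfolding polynomials_in_def h_def by blast
  ultimately show "\<exists>h. h \<in> polynomials_in v \<and> (\<forall>s\<in>K. cmod (h s - 1 / (1 - c * v s)) < e)"
    by (intro exI[of _ h]) simp
qed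

lemma polynomials_in_self: "v \<in> polynomials_in v"
  unfolding polynomials_in_def by (rule image_eqI[of _ _ "[:0, 1:]"]) auto

text \<open>With \<open>v s = 1 / (s - w)\<close> one has \<open>1 / (s - w') = v s / (1 - (w' - w) v s)\<close>, a geometric series with ratio at
most \<open>dist w w' / d\<close> on \<open>K\<close>.\<close>

lemma nearby_pole_approximable:
  assumes d: "\<And>s. s \<in> K \<Longrightarrow> d \<le> dist w s" and w': "dist w w' < d"
  shows "approximable_on K (polynomials_in (\<lambda>s. 1 / (s - w))) (\<lambda>s. 1 / (s - w'))"
    and "bounded ((\<lambda>s. 1 / (s - w)) ` K)"
proof -
  let ?v = "\<lambda>s. 1 / (s - w)"
  have "d > 0" using w' zero_le_dist order_le_less_trans by blast
  have v: "cmod (?v s) \<le> 1 / d" if "s \<in> K" for s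
    using d[OF that] \<open>d > 0\<close> by (auto simp: norm_divide dist_norm norm_minus_commute intro!: frac_le)
  then show bdd: "bounded (?v ` K)" unfolding bounded_iff by blast
  have "approximable_on K (polynomials_in ?v) (\<lambda>s. 1 / (1 - (w' - w) * ?v s))"
  proof (rule geometric_series_approximable[where v = ?v and q = "dist w w' / d"])
    show "0 \<le> dist w w' / d" "dist w w' / d < 1" using \<open>d > 0\<close> w' by auto
    show "cmod ((w' - w) * ?v s) \<le> dist w w' / d" if "s \<in> K" for s
    proof -
      have "cmod ((w' - w) * ?v s) = dist w w' * cmod (?v s)"
        by (simp only: norm_mult dist_norm norm_minus_commute)
      also have "\<dots> \<le> dist w w' * (1 / d)" by (intro mult_left_mono v that) simp
      finally show ?thesis by simp
    qed
  qed
  from approximable_on_mult[OF bounded_algebra_polynomials_in[OF bdd] this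
      approximable_on_member[OF polynomials_in_self]]
  show "approximable_on K (polynomials_in ?v) (\<lambda>s. 1 / (s - w'))"
  proof (rule approximable_on_cong)
    fix s assume s: "s \<in> K"
    have "s \<noteq> w" "s \<noteq> w'" using d[OF s] w' \<open>d > 0\<close> by auto
    then show "1 / (1 - (w' - w) * ?v s) * ?v s = 1 / (s - w')"
      by (simp add: divide_simps)
  qed
qed

text \<open>The pole at \<open>\<infinity>\<close> plays the role of the nearby pole here: \<open>1 / (s - w) = - (1 / w) / (1 - s / w)\<close>.\<close>

lemma distant_pole_approximable:
  assumes r: "\<And>s. s \<in> K \<Longrightarrow> cmod s \<le> r" "0 \<le> r" "r < cmod w"
  shows "approximable_on K (polynomials_in (\<lambda>s. s)) (\<lambda>s. 1 / (s - w))"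
proof -
  have bdd: "bounded ((\<lambda>s. s) ` K)" using r(1) unfolding bounded_iff by auto
  have "approximable_on K (polynomials_in (\<lambda>s. s)) (\<lambda>s. 1 / (1 - (1 / w) * s))"
  proof (rule geometric_series_approximable[where v = "\<lambda>s. s" and q = "r / cmod w"])
    show "0 \<le> r / cmod w" using r(2) by simp
    have "0 < cmod w" using r(2,3) by linarith
    then show "r / cmod w < 1" using r(3) by (simp only: divide_less_eq_1_pos)
    show "cmod ((1 / w) * s) \<le> r / cmod w" if "s \<in> K" for s
      using r(1)[OF that] by (auto simp: norm_divide intro!: divide_right_mono)
  qed
  from approximable_on_scale[OF bounded_algebra_linear[OF bounded_algebra_polynomials_in[OF bdd]] this, of "- 1 / w"]
  show ?thesis
  proof (rule approximable_on_cong)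
    fix s assume s: "s \<in> K"
    have "s \<noteq> w" "w \<noteq> 0" using r s by force+
    then show "- 1 / w * (1 / (1 - (1 / w) * s)) = 1 / (s - w)"
      by (simp add: divide_simps)
  qed
qed

text \<open>Since all polynomials in \<open>u\<close> are treated at once, it is enough to approximate simple poles: their powers come
along, and partial fractions do not enter.\<close>

lemma approximable_on_poly_trans:
  assumes v: "bounded (v ` K)" and u: "approximable_on K (polynomials_in v) u"
    and F: "\<And>p. approximable_on K F (\<lambda>s. poly p (v s))"
  shows "approximable_on K F (\<lambda>s. poly p (u s))"
proof (rule approximable_on_trans)
  show "approximable_on K (polynomials_in v) (\<lambda>s. poly p (u s))"
    by (rule approximable_on_poly[OF bounded_algebra_polynomials_in[OF v] u])
  show "approximable_on K F g" if "g \<in> polynomials_in v" for g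
    using that F unfolding polynomials_in_def by auto
qed

text \<open>Call \<open>w\<close> good if the conclusion holds for it. By the geometric series, two points whose distance is less
than the distance of the first from \<open>K\<close> are such that goodness of the first implies that of the second. Near
any point of a component \<open>U\<close> of the complement goodness is therefore constant, hence constant on \<open>U\<close>. A good
point exists in \<open>U\<close> by hypothesis if \<open>U\<close> is bounded, and far away from the origin if it is not.\<close>

lemma pole_pushing:
  assumes K: "compact K"
    and poly: "\<And>p. approximable_on K F (\<lambda>s. poly p s)"
    and holes: "\<And>U. U \<in> components (- K) \<Longrightarrow> bounded U \<Longrightarrow>
      \<exists>a\<in>U. \<forall>p. approximable_on K F (\<lambda>s. poly p (1 / (s - a)))"
    and w: "w \<notin> K"
  shows "approximable_on K F (\<lambda>s. poly p (1 / (s - w)))"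
proof -
  define good where "good w \<longleftrightarrow> (\<forall>p. approximable_on K F (\<lambda>s. poly p (1 / (s - w))))" for w
  define U where "U = connected_component_set (- K) w"
  have U: "U \<in> components (- K)" "w \<in> U" "connected U" "U \<subseteq> - K"
    using w by (auto simp: U_def components_def connected_component_subset)
  obtain r where r: "r > 0" "\<And>s. s \<in> K \<Longrightarrow> cmod s \<le> r"
    using compact_imp_bounded[OF K] unfolding bounded_pos by auto
  have "\<exists>a\<in>U. good a"
  proof (cases "bounded U")
    case True
    then show ?thesis using holes[OF U(1)] unfolding good_def by blast
  next
    case False
    then obtain a where a: "a \<in> U" "r < cmod a" unfolding bounded_iff by (meson not_le)
    have "good a"
      unfolding good_def
    proof
      fix p
      show "approximable_on K F (\<lambda>s. poly p (1 / (s - a)))"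
      proof (rule approximable_on_poly_trans)
        show "bounded ((\<lambda>s. s) ` K)" using compact_imp_bounded[OF K] by simp
        show "approximable_on K (polynomials_in (\<lambda>s. s)) (\<lambda>s. 1 / (s - a))"
          by (rule distant_pole_approximable[of K r]) (use r a(2) in simp_all)
        show "approximable_on K F (\<lambda>s. poly p s)" for p by (rule poly)
      qed
    qed
    then show ?thesis using a by blast
  qed
  then obtain a where a: "a \<in> U" "good a" by blast
  have "good w"
  proof (rule connected_induction_simple[of U a w good])
    fix b assume b: "b \<in> U"
    have "open (- K)" using K by (simp add: compact_imp_closed open_Compl)
    then obtain d where d: "d > 0" "ball b d \<subseteq> - K" using b U(4) open_contains_ball by blast
    \<comment> \<open>If \<open>d\<close> is a lower bound for the distance of \<open>b\<close> from \<open>K\<close>, points within \<open>d / 3\<close> of \<open>b\<close> have distance at least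
      \<open>2 d / 3\<close> from \<open>K\<close> and less than \<open>2 d / 3\<close> from each other.\<close>
    show "\<exists>T. openin (top_of_set U) T \<and> b \<in> T \<and> (\<forall>x\<in>T. \<forall>y\<in>T. good x \<longrightarrow> good y)"
    proof (intro exI[of _ "U \<inter> ball b (d / 3)"] conjI ballI impI)
      show "openin (top_of_set U) (U \<inter> ball b (d / 3))" by (simp add: openin_open_Int)
      show "b \<in> U \<inter> ball b (d / 3)" using b d by simp
      fix x y assume xy: "x \<in> U \<inter> ball b (d / 3)" "y \<in> U \<inter> ball b (d / 3)" "good x"
      have dist: "2 * d / 3 \<le> dist x s" if "s \<in> K" for s
      proof -
        have "d \<le> dist b s" using that d(2) by (force simp: subset_iff)
        then show ?thesis using xy(1) dist_triangle[of b s x] by (simp add: dist_commute)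
      qed
      have "dist x y < 2 * d / 3" using xy(1,2) dist_triangle[of x y b] by (simp add: dist_commute)
      note near = nearby_pole_approximable[OF dist this]
      show "good y" unfolding good_def
        using approximable_on_poly_trans[OF near(2,1)] xy(3) unfolding good_def by blast
    qed
  qed (use U a in auto)
  then show ?thesis by (simp add: good_def)
qed

section \<open>Cauchy integrals along segments\<close>

text \<open>One subdivision serves all parameters, by uniform continuity of the integrand in both variables.\<close>

lemma parametric_riemann_sum:
  fixes \<phi> :: "real \<Rightarrow> 'a::metric_space \<Rightarrow> complex"
  assumes K: "compact K" and cont: "continuous_on ({0..1} \<times> K) (\<lambda>(t, s). \<phi> t s)" and e: "e > 0"
  shows "\<exists>n::nat. \<forall>s\<in>K. cmod ((\<Sum>k<n. \<phi> (real k / real n) s / of_nat n) - integral {0..1} (\<lambda>t. \<phi> t s)) < e"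
proof -
  have "uniformly_continuous_on ({0..1} \<times> K) (\<lambda>(t, s). \<phi> t s)"
    using K cont by (intro compact_uniformly_continuous compact_Times) auto
  then obtain d where d: "d > 0"
    and d': "\<And>x x'. x \<in> {0..1} \<times> K \<Longrightarrow> x' \<in> {0..1} \<times> K \<Longrightarrow> dist x' x < d \<Longrightarrow>
      dist ((\<lambda>(t, s). \<phi> t s) x') ((\<lambda>(t, s). \<phi> t s) x) < e / 2"
    by (rule uniformly_continuous_onE[of _ _ "e / 2"]) (use e in simp_all)
  have close: "cmod (\<phi> t s - \<phi> t' s) < e / 2"
    if "t \<in> {0..1}" "t' \<in> {0..1}" "s \<in> K" "dist t t' < d" for t t' s
    using d'[of "(t', s)" "(t, s)"] that by (simp add: dist_Pair_Pair dist_norm)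
  obtain n :: nat where n: "n > 0" "1 / n < d"
    using d real_arch_inverse[of d] by (auto simp: inverse_eq_divide)
  have "cmod ((\<Sum>k<n. \<phi> (real k / real n) s / of_nat n) - integral {0..1} (\<lambda>t. \<phi> t s)) < e" if s: "s \<in> K" for s
  proof -
    let ?g = "\<lambda>t. \<phi> t s"
    have pair: "continuous_on {0..1} (\<lambda>t::real. (t, s))"
      by (rule continuous_on_Pair[OF continuous_on_id continuous_on_const])
    have "(\<lambda>t::real. (t, s)) ` {0..1} \<subseteq> {0..1} \<times> K" using s by auto
    from continuous_on_compose2[OF cont pair this] have cg: "continuous_on {0..1} ?g" by simp
    have int: "?g integrable_on {a..b}" if "0 \<le> a" "b \<le> 1" for a b
      using that by (intro integrable_continuous_real continuous_on_subset[OF cg]) auto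
    have split: "integral {0..m / n} ?g = (\<Sum>k<m. integral {k / n..Suc k / n} ?g)" if "m \<le> n" for m
      using that
    proof (induction m)
      case (Suc m)
      have "Suc m / n \<le> 1" using Suc.prems n(1) by simp
      then have "integral {0..Suc m / n} ?g = integral {0..m / n} ?g + integral {m / n..Suc m / n} ?g"
        using n(1) by (intro Henstock_Kurzweil_Integration.integral_combine[symmetric] int)
          (auto simp: divide_right_mono)
      then show ?case using Suc by simp
    qed simp
    have piece: "cmod (\<phi> (k / n) s / n - integral {k / n..Suc k / n} ?g) \<le> e / 2 * (1 / n)" if k: "k < n" for k
    proof -
      have le: "k / n \<le> Suc k / n" "Suc k / n - k / n = 1 / n" "0 \<le> k / n" "Suc k / n \<le> 1"
        using n(1) k by (auto simp: field_simps)
      have "\<phi> (k / n) s / n = integral {k / n..Suc k / n} (\<lambda>t. \<phi> (k / n) s)"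
        using le(1,2) by (simp add: scaleR_conv_of_real)
      then have "\<phi> (k / n) s / n - integral {k / n..Suc k / n} ?g =
          integral {k / n..Suc k / n} (\<lambda>t. \<phi> (k / n) s - \<phi> t s)"
        using le int by (subst integral_diff) auto
      also have "cmod \<dots> \<le> e / 2 * (Suc k / n - k / n)"
      proof (rule integral_bound)
        show "continuous_on {k / n..Suc k / n} (\<lambda>t. \<phi> (k / n) s - \<phi> t s)"
          using le by (intro continuous_intros continuous_on_subset[OF cg]) auto
        show "cmod (\<phi> (k / n) s - \<phi> t s) \<le> e / 2" if t: "t \<in> {k / n..Suc k / n}" for t
        proof -
          have "dist (k / n) t < d" using t le(2) n(2) by (auto simp: dist_real_def)
          moreover have "t \<in> {0..1}" "k / n \<in> {0..1}"
            using t le unfolding atLeastAtMost_iff by linarith+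
          ultimately show ?thesis using close s by (intro less_imp_le) blast
        qed
      qed (use le in auto)
      finally show ?thesis by (simp only: le(2))
    qed
    have "(\<Sum>k<n. \<phi> (real k / real n) s / of_nat n) - integral {0..1} ?g =
        (\<Sum>k<n. \<phi> (k / n) s / n - integral {k / n..Suc k / n} ?g)"
      using split[of n] n(1) by (simp add: sum_subtractf)
    also have "cmod \<dots> \<le> (\<Sum>k<n. e / 2 * (1 / n))"
      by (rule sum_norm_le) (use piece in auto)
    also have "\<dots> < e" using n(1) e by simp
    finally show ?thesis .
  qed
  then show ?thesis by (intro exI[of _ n] ballI)
qed

text \<open>The Riemann sums of the Cauchy integral are linear combinations of functions \<open>1 / (s - w)\<close> with \<open>w\<close> on the
segment.\<close>

lemma cauchy_segment_approximable:
  assumes K: "compact K" and F: "linear_family F"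
    and f: "continuous_on (closed_segment a b) f" and disj: "closed_segment a b \<inter> K = {}"
    and poles: "\<And>w. w \<in> closed_segment a b \<Longrightarrow> approximable_on K F (\<lambda>s. 1 / (s - w))"
  shows "approximable_on K F (\<lambda>s. contour_integral (linepath a b) (\<lambda>w. f w / (w - s)))"
proof (rule approximable_on_closed)
  fix e :: real assume e: "e > 0"
  define \<phi> where "\<phi> t s = f (linepath a b t) / (linepath a b t - s) * (b - a)" for t s
  have seg: "linepath a b t \<in> closed_segment a b" if "t \<in> {0..1}" for t
    using that by (rule linepath_in_path)
  have cl: "continuous_on ({0..1} \<times> K) (\<lambda>x. linepath a b (fst x))"
    unfolding linepath_def by (intro continuous_intros)
  have cf: "continuous_on ({0..1} \<times> K) (\<lambda>x. f (linepath a b (fst x)))"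
    by (rule continuous_on_compose2[OF f cl]) (use seg in auto)
  have "continuous_on ({0..1} \<times> K) (\<lambda>x. \<phi> (fst x) (snd x))"
    unfolding \<phi>_def
  proof (intro continuous_intros cf cl ballI)
    fix x :: "real \<times> complex" assume "x \<in> {0..1} \<times> K"
    then show "linepath a b (fst x) - snd x \<noteq> 0" using seg[of "fst x"] disj by auto
  qed
  then have \<phi>: "continuous_on ({0..1} \<times> K) (\<lambda>(t, s). \<phi> t s)" by (simp add: case_prod_unfold)
  obtain n :: nat where n:
    "\<forall>s\<in>K. cmod ((\<Sum>k<n. \<phi> (real k / real n) s / of_nat n) - integral {0..1} (\<lambda>t. \<phi> t s)) < e"
    using parametric_riemann_sum[OF K \<phi> e] by (elim exE)
  have int: "contour_integral (linepath a b) (\<lambda>w. f w / (w - s)) = integral {0..1} (\<lambda>t. \<phi> t s)" for s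
    unfolding contour_integral_integral \<phi>_def by simp
  have "approximable_on K F (\<lambda>s. \<Sum>k<n. (- f (linepath a b (real k / real n)) * (b - a) / of_nat n) *
      (1 / (s - linepath a b (real k / real n))))"
    using seg by (intro approximable_on_sum F approximable_on_scale poles) auto
  moreover have "(- f w * (b - a) / of_nat n) * (1 / (s - w)) = f w / (w - s) * (b - a) / of_nat n" for w s
  proof -
    have "1 / (s - w) = - (1 / (w - s))" by (simp add: minus_divide_right)
    then show ?thesis by (simp only:) simp
  qed
  ultimately have "approximable_on K F (\<lambda>s. \<Sum>k<n. \<phi> (k / n) s / n)"
    unfolding \<phi>_def by simp
  then show "\<exists>v. approximable_on K F v \<and>
      (\<forall>s\<in>K. cmod (v s - contour_integral (linepath a b) (\<lambda>w. f w / (w - s))) < e)"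
    using n unfolding int by (intro exI[of _ "\<lambda>s. \<Sum>k<n. \<phi> (real k / real n) s / of_nat n"]) simp
qed

section \<open>The Cauchy formula on a grid of squares\<close>

definition grid_point :: "real \<Rightarrow> int \<Rightarrow> int \<Rightarrow> complex" where
  "grid_point \<delta> i j = Complex (\<delta> * of_int i) (\<delta> * of_int j)"

definition grid_cell :: "real \<Rightarrow> int \<Rightarrow> int \<Rightarrow> complex set" where
  "grid_cell \<delta> i j = cbox (grid_point \<delta> i j) (grid_point \<delta> (i + 1) (j + 1))"

lemma grid_cell_iff:
  "z \<in> grid_cell \<delta> i j \<longleftrightarrow>
     \<delta> * of_int i \<le> Re z \<and> Re z \<le> \<delta> * (of_int i + 1) \<and> \<delta> * of_int j \<le> Im z \<and> Im z \<le> \<delta> * (of_int j + 1)"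
  by (auto simp: grid_cell_def grid_point_def in_cbox_complex_iff)

text \<open>Telescoping over a set of arbitrary shape. An edge shared by two adjacent cells of \<open>S\<close> gets the coefficient \<open>0\<close>;
the edges that remain form the boundary of \<open>S\<close>.\<close>

lemma sum_shift_difference:
  fixes g :: "'i \<Rightarrow> complex"
  assumes T: "finite T" "S \<subseteq> T" "\<tau> ` S \<subseteq> T"
    and inv: "\<And>x. \<sigma> (\<tau> x) = x" "\<And>x. \<tau> (\<sigma> x) = x"
  shows "(\<Sum>x\<in>S. g x - g (\<tau> x)) = (\<Sum>x\<in>T. (of_bool (x \<in> S) - of_bool (\<sigma> x \<in> S)) * g x)"
proof -
  have "(\<Sum>x\<in>S. g x) = (\<Sum>x\<in>T. of_bool (x \<in> S) * g x)"
    using T by (intro sum.mono_neutral_cong_left) auto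
  moreover have "(\<Sum>x\<in>S. g (\<tau> x)) = (\<Sum>x\<in>\<tau> ` S. g x)"
    using inv(1) by (subst sum.reindex) (auto intro: inj_on_inverseI)
  moreover have "(\<Sum>x\<in>\<tau> ` S. g x) = (\<Sum>x\<in>T. of_bool (\<sigma> x \<in> S) * g x)"
  proof (rule sum.mono_neutral_cong_left)
    show "\<forall>x\<in>T - \<tau> ` S. of_bool (\<sigma> x \<in> S) * g x = 0"
    proof
      fix x assume "x \<in> T - \<tau> ` S"
      then have "\<sigma> x \<notin> S" using inv(2) by (metis DiffD2 imageI)
      then show "of_bool (\<sigma> x \<in> S) * g x = 0" by simp
    qed
  qed (use T inv in auto)
  ultimately show ?thesis by (simp add: sum_subtractf left_diff_distrib)
qed

text \<open>The four sides are grouped as bottom minus top and right minus left, the form that telescopes over a grid.\<close>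

lemma rectangle_integral:
  fixes z :: complex
  assumes f: "f holomorphic_on cbox a c" and ac: "Re a < Re c" "Im a < Im c"
    and z: "z \<notin> cbox a c - box a c"
  defines "b \<equiv> Complex (Re c) (Im a)" and "d \<equiv> Complex (Re a) (Im c)" and "g \<equiv> (\<lambda>w. f w / (w - z))"
  shows "contour_integral (linepath a b) g - contour_integral (linepath d c) g
       + (contour_integral (linepath b c) g - contour_integral (linepath a d) g)
       = (if z \<in> box a c then 2 * pi * \<i> * f z else 0)"
proof -
  have path: "path_image (rectpath a c) = cbox a c - box a c"
    using ac by (intro path_image_rectpath_cbox_minus_box) auto
  have image: "path_image (rectpath a c) = closed_segment a b \<union> closed_segment b c \<union> closed_segment c d \<union> closed_segment d a"
    by (simp add: rectpath_def Let_def b_def d_def path_image_join Un_assoc)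
  have cont: "continuous_on (path_image (rectpath a c)) g"
    unfolding g_def path using z
    by (intro continuous_intros continuous_on_subset[OF holomorphic_on_imp_continuous_on[OF f]]) auto
  then have int: "g contour_integrable_on linepath a b" "g contour_integrable_on linepath b c"
    "g contour_integrable_on linepath c d" "g contour_integrable_on linepath d a"
    and rev: "continuous_on (closed_segment c d) g" "continuous_on (closed_segment d a) g"
    unfolding image by (auto intro!: contour_integrable_continuous_linepath elim: continuous_on_subset)
  have "contour_integral (rectpath a c) g =
      contour_integral (linepath a b) g + (contour_integral (linepath b c) g +
        (contour_integral (linepath c d) g + contour_integral (linepath d a) g))"
    unfolding rectpath_def Let_def b_def[symmetric] d_def[symmetric]
    using int by (simp add: contour_integrable_join valid_path_join)
  also have "contour_integral (linepath c d) g = - contour_integral (linepath d c) g"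
    by (rule contour_integral_reverse_linepath[OF rev(1)])
  also have "contour_integral (linepath d a) g = - contour_integral (linepath a d) g"
    by (rule contour_integral_reverse_linepath[OF rev(2)])
  finally have eq: "contour_integral (linepath a b) g - contour_integral (linepath d c) g
       + (contour_integral (linepath b c) g - contour_integral (linepath a d) g)
       = contour_integral (rectpath a c) g" by simp
  show ?thesis
  proof (cases "z \<in> box a c")
    case True
    have "(g has_contour_integral (2 * pi * \<i> * winding_number (rectpath a c) z * f z)) (rectpath a c)"
      unfolding g_def using True z path
      by (intro Cauchy_integral_formula_convex_simple[where S = "cbox a c"] f) (auto simp: interior_cbox)
    then show ?thesis
      unfolding eq using True winding_number_rectpath[OF True] by (simp add: contour_integral_unique)
  next
    case False
    then have "z \<notin> cbox a c" using z by auto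
    then have "g holomorphic_on cbox a c" unfolding g_def by (intro holomorphic_intros f) auto
    then have "(g has_contour_integral 0) (rectpath a c)"
      using path by (intro Cauchy_theorem_convex_simple[where S = "cbox a c"]) auto
    then show ?thesis unfolding eq using False by (simp add: contour_integral_unique)
  qed
qed

text \<open>Needed to extend the grid formula to points lying on grid lines.\<close>

lemma cauchy_segment_continuous:
  assumes f: "continuous_on (closed_segment a b) f" and z: "z \<notin> closed_segment a b"
  shows "isCont (\<lambda>z. contour_integral (linepath a b) (\<lambda>w. f w / (w - z))) z"
proof -
  have "((\<lambda>u. f u / (u - w) ^ 1) has_contour_integral contour_integral (linepath a b) (\<lambda>u. f u / (u - w))) (linepath a b)"
    if "w \<in> UNIV - path_image (linepath a b)" for w
    using that
    by (auto intro!: has_contour_integral_integral contour_integrable_continuous_linepath continuous_intros f)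
  from Cauchy_next_derivative(2)[of "linepath a b" f "cmod (b - a)" UNIV 1 _ z, OF _ _ this] z f
  show ?thesis by (auto intro: DERIV_isCont)
qed

text \<open>For a point inside one cell, the Cauchy integrals over the boundaries of all other cells vanish.\<close>

lemma grid_cell_of_interior_point_unique:
  assumes "\<delta> > 0" "z \<in> box (grid_point \<delta> i j) (grid_point \<delta> (i + 1) (j + 1))" "z \<in> grid_cell \<delta> i' j'"
  shows "i' = i \<and> j' = j"
proof -
  have unique: "m' = m" if "\<delta> * of_int m < x" "x < \<delta> * (of_int m + 1)" "\<delta> * of_int m' \<le> x" "x \<le> \<delta> * (of_int m' + 1)"
    for m m' :: int and x :: real
  proof -
    have "\<delta> * of_int m' < \<delta> * (of_int m + 1)" "\<delta> * of_int m < \<delta> * (of_int m' + 1)"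
      using that by linarith+
    then have "real_of_int m' < of_int m + 1" "real_of_int m < of_int m' + 1"
      using assms(1) by (simp_all only: mult_less_cancel_left_pos)
    then show ?thesis by linarith
  qed
  show ?thesis
    using assms(2,3) unfolding grid_cell_iff
    by (auto simp: grid_point_def in_box_complex_iff intro!: unique)
qed

text \<open>Let \<open>S\<close> be the set of cells of a fine grid that meet \<open>K\<close>. Summing the Cauchy integrals over the boundaries of the
cells in \<open>S\<close> gives \<open>2 \<pi> \<i> f z\<close> for \<open>z\<close> inside a cell of \<open>S\<close>. Edges between two cells of \<open>S\<close> cancel, and an
edge that survives does not meet \<open>K\<close>, because otherwise both of its adjacent cells would meet \<open>K\<close> and belong to \<open>S\<close>.
A point of \<open>K\<close> on a grid line is a limit of points inside a cell of \<open>S\<close>, and both sides are continuous there.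

The index set is a sum type: the left summand enumerates horizontal edges, the right one vertical edges, each
by the cell of which it is the lower or left side.\<close>

lemma Cauchy_grid_representation:
  assumes \<Omega>: "open \<Omega>" and K: "compact K" "K \<subseteq> \<Omega>" and f: "f holomorphic_on \<Omega>"
  obtains I :: "(int \<times> int + int \<times> int) set" and c a b where
    "finite I" "\<And>x. x \<in> I \<Longrightarrow> closed_segment (a x) (b x) \<subseteq> \<Omega> - K"
    "\<And>z. z \<in> K \<Longrightarrow> f z = (\<Sum>x\<in>I. c x * contour_integral (linepath (a x) (b x)) (\<lambda>w. f w / (w - z)))"
proof -
  obtain e where e: "e > 0" "(\<Union>z\<in>K. ball z e) \<subseteq> \<Omega>"
    using compact_subset_open_imp_ball_epsilon_subset[OF K(1) \<Omega> K(2)] by blast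
  \<comment> \<open>Two points of a cell are at distance at most \<open>2 \<delta> < e\<close>, so cells that meet \<open>K\<close> stay in \<open>\<Omega>\<close>.\<close>
  define \<delta> where "\<delta> = e / 3"
  have \<delta>: "\<delta> > 0" using e by (simp add: \<delta>_def)
  let ?p = "grid_point \<delta>" and ?Q = "grid_cell \<delta>"
  define S where "S = {(i, j). ?Q i j \<inter> K \<noteq> {}}"
  have cell: "?Q i j \<subseteq> \<Omega>" if S: "(i, j) \<in> S" for i j
  proof
    fix w assume w: "w \<in> ?Q i j"
    obtain z where z: "z \<in> ?Q i j" "z \<in> K" using S by (auto simp: S_def)
    have "\<bar>Re (z - w)\<bar> \<le> \<delta>" "\<bar>Im (z - w)\<bar> \<le> \<delta>"
      using w z(1) unfolding grid_cell_iff by (auto simp: algebra_simps abs_le_iff)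
    then have "cmod (z - w) \<le> 2 * \<delta>" using cmod_le[of "z - w"] by linarith
    then have "w \<in> ball z e" using e(1) by (simp add: dist_norm \<delta>_def)
    then show "w \<in> \<Omega>" using e(2) z(2) by blast
  qed
  have "finite S"
  proof -
    obtain r where r: "\<And>z. z \<in> K \<Longrightarrow> cmod z \<le> r"
      using compact_imp_bounded[OF K(1)] unfolding bounded_iff by blast
    define N where "N = \<lceil>r / \<delta>\<rceil> + 1"
    have range: "m \<in> {- N..N}" if "\<delta> * of_int m \<le> x" "x \<le> \<delta> * (of_int m + 1)" "\<bar>x\<bar> \<le> r" for m :: int and x
    proof -
      have "\<delta> * of_int m \<le> r" "- r \<le> \<delta> * (of_int m + 1)" using that by linarith+
      then have "real_of_int m \<le> r / \<delta>" "- (r / \<delta>) \<le> of_int m + 1"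
        using \<delta> by (simp_all add: field_simps)
      then show ?thesis unfolding N_def atLeastAtMost_iff by linarith
    qed
    have "S \<subseteq> {- N..N} \<times> {- N..N}"
    proof
      fix x assume x: "x \<in> S"
      obtain i j where ij: "x = (i, j)" by (cases x)
      obtain z where z: "z \<in> ?Q i j" "z \<in> K" using x ij by (auto simp: S_def)
      have "\<bar>Re z\<bar> \<le> r" "\<bar>Im z\<bar> \<le> r"
        using r[OF z(2)] abs_Re_le_cmod[of z] abs_Im_le_cmod[of z] by linarith+
      then show "x \<in> {- N..N} \<times> {- N..N}" using range z(1) unfolding ij grid_cell_iff by blast
    qed
    then show ?thesis by (rule finite_subset) simp
  qed
  define up down right left :: "int \<times> int \<Rightarrow> int \<times> int" where
    "up = (\<lambda>(i, j). (i, j + 1))" and "down = (\<lambda>(i, j). (i, j - 1))" and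
    "right = (\<lambda>(i, j). (i + 1, j))" and "left = (\<lambda>(i, j). (i - 1, j))"
  note moves = up_def down_def right_def left_def
  define T where "T = S \<union> up ` S \<union> right ` S"
  have "finite T" using \<open>finite S\<close> by (simp add: T_def)
  \<comment> \<open>A horizontal edge is the bottom of the cell with its index and the top of the cell below, where it is traversed
    in the opposite direction. A vertical edge is the left side of its cell, traversed downwards, and the right
    side of the cell to the left; this accounts for the minus sign in front of \<open>cV\<close> in \<open>c\<close>.\<close>
  define cH :: "int \<times> int \<Rightarrow> complex" where "cH x = of_bool (x \<in> S) - of_bool (down x \<in> S)" for x
  define cV :: "int \<times> int \<Rightarrow> complex" where "cV x = of_bool (x \<in> S) - of_bool (left x \<in> S)" for x
  define IH IV where "IH = {x \<in> T. cH x \<noteq> 0}" and "IV = {x \<in> T. cV x \<noteq> 0}"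
  define p where "p = (\<lambda>(i, j). ?p i j)"
  define I where "I = IH <+> IV"
  define a where "a = case_sum p p"
  define b where "b = case_sum (p \<circ> right) (p \<circ> up)"
  define c where "c = (\<lambda>x. case_sum cH (\<lambda>x. - cV x) x / (2 * pi * \<i>))"
  have fin: "finite IH" "finite IV" using \<open>finite T\<close> by (auto simp: IH_def IV_def)

  have edge_in_cells:
    "closed_segment (p (i, j)) (p (right (i, j))) \<subseteq> ?Q i j \<inter> ?Q i (j - 1)"
    "closed_segment (p (i, j)) (p (up (i, j))) \<subseteq> ?Q i j \<inter> ?Q (i - 1) j" for i j
    using \<delta> unfolding grid_cell_def
    by (intro Int_greatest closed_segment_subset;
        simp add: p_def moves grid_point_def in_cbox_complex_iff)+
  have segments: "closed_segment (a x) (b x) \<subseteq> \<Omega> - K" if "x \<in> I" for x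
  proof (cases x)
    case (Inl y)
    obtain i j where y: "y = (i, j)" by (cases y)
    have "((i, j) \<in> S) \<noteq> ((i, j - 1) \<in> S)"
      using that Inl y by (auto simp: I_def IH_def cH_def moves)
    then show ?thesis
      using edge_in_cells(1)[of i j] cell[of i j] cell[of i "j - 1"]
      unfolding Inl y a_def b_def by (auto simp: S_def)
  next
    case (Inr y)
    obtain i j where y: "y = (i, j)" by (cases y)
    have "((i, j) \<in> S) \<noteq> ((i - 1, j) \<in> S)"
      using that Inr y by (auto simp: I_def IV_def cV_def moves)
    then show ?thesis
      using edge_in_cells(2)[of i j] cell[of i j] cell[of "i - 1" j]
      unfolding Inr y a_def b_def by (auto simp: S_def)
  qed

  define R where "R z = (\<Sum>x\<in>I. c x * contour_integral (linepath (a x) (b x)) (\<lambda>w. f w / (w - z)))" for z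
  have interior: "R z = f z" if S: "(i, j) \<in> S" and z: "z \<in> box (?p i j) (?p (i + 1) (j + 1))" for i j z
  proof -
    define H where "H x = contour_integral (linepath (p x) (p (right x))) (\<lambda>w. f w / (w - z))" for x
    define V where "V x = contour_integral (linepath (p x) (p (up x))) (\<lambda>w. f w / (w - z))" for x
    have "(H x - H (up x)) - (V x - V (right x)) = (if x = (i, j) then 2 * pi * \<i> * f z else 0)"
      if "x \<in> S" for x
    proof -
      obtain k l where x: "x = (k, l)" by (cases x)
      have unique: "z \<in> ?Q k l \<Longrightarrow> x = (i, j)"
        using grid_cell_of_interior_point_unique[OF \<delta> z, of k l] x by auto
      have sub: "box (?p k l) (?p (k + 1) (l + 1)) \<subseteq> ?Q k l"
        unfolding grid_cell_def by (rule box_subset_cbox)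
      have "f holomorphic_on cbox (?p k l) (?p (k + 1) (l + 1))"
        using cell[of k l] that x holomorphic_on_subset[OF f] by (simp add: grid_cell_def)
      moreover have "z \<notin> cbox (?p k l) (?p (k + 1) (l + 1)) - box (?p k l) (?p (k + 1) (l + 1))"
        using unique z x unfolding grid_cell_def by auto
      moreover have "Re (?p k l) < Re (?p (k + 1) (l + 1))" "Im (?p k l) < Im (?p (k + 1) (l + 1))"
        using \<delta> by (simp_all add: grid_point_def)
      ultimately have "(H x - H (up x)) + (V (right x) - V x)
          = (if z \<in> box (?p k l) (?p (k + 1) (l + 1)) then 2 * pi * \<i> * f z else 0)"
        using rectangle_integral[of f "?p k l" "?p (k + 1) (l + 1)" z]
        by (simp add: H_def V_def x p_def moves grid_point_def)
      also have "z \<in> box (?p k l) (?p (k + 1) (l + 1)) \<longleftrightarrow> x = (i, j)"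
        using unique sub z x by auto
      finally show ?thesis by (simp add: algebra_simps)
    qed
    then have "(\<Sum>x\<in>S. (H x - H (up x)) - (V x - V (right x))) = (\<Sum>x\<in>S. if x = (i, j) then 2 * pi * \<i> * f z else 0)"
      by (intro sum.cong) auto
    also have "\<dots> = 2 * pi * \<i> * f z" using \<open>finite S\<close> S by simp
    finally have "2 * pi * \<i> * f z = (\<Sum>x\<in>S. H x - H (up x)) - (\<Sum>x\<in>S. V x - V (right x))"
      by (simp add: sum_subtractf)
    also have "(\<Sum>x\<in>S. H x - H (up x)) = (\<Sum>x\<in>T. cH x * H x)"
      unfolding cH_def by (rule sum_shift_difference[OF \<open>finite T\<close>]) (auto simp: T_def moves)
    also have "\<dots> = (\<Sum>x\<in>IH. cH x * H x)"
      using \<open>finite T\<close> by (intro sum.mono_neutral_right) (auto simp: IH_def)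
    also have "(\<Sum>x\<in>S. V x - V (right x)) = (\<Sum>x\<in>T. cV x * V x)"
      unfolding cV_def by (rule sum_shift_difference[OF \<open>finite T\<close>]) (auto simp: T_def moves)
    also have "\<dots> = (\<Sum>x\<in>IV. cV x * V x)"
      using \<open>finite T\<close> by (intro sum.mono_neutral_right) (auto simp: IV_def)
    finally have main: "2 * pi * \<i> * f z = (\<Sum>x\<in>IH. cH x * H x) - (\<Sum>x\<in>IV. cV x * V x)" .
    have "R z = (\<Sum>x\<in>IH. cH x * H x / (2 * pi * \<i>)) + (\<Sum>x\<in>IV. - (cV x * V x / (2 * pi * \<i>)))"
      unfolding R_def I_def using fin
      by (simp add: sum.Plus a_def b_def c_def H_def V_def)
    also have "\<dots> = (2 * pi * \<i> * f z) / (2 * pi * \<i>)"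
      unfolding main by (simp add: sum_divide_distrib sum_negf diff_divide_distrib)
    finally show ?thesis by simp
  qed

  have "R z = f z" if z: "z \<in> K" for z
  proof -
    define i j where "i = \<lfloor>Re z / \<delta>\<rfloor>" and "j = \<lfloor>Im z / \<delta>\<rfloor>"
    have floor: "\<delta> * of_int \<lfloor>x / \<delta>\<rfloor> \<le> x" "x \<le> \<delta> * (of_int \<lfloor>x / \<delta>\<rfloor> + 1)" for x
    proof -
      have "of_int \<lfloor>x / \<delta>\<rfloor> \<le> x / \<delta>" "x / \<delta> \<le> of_int \<lfloor>x / \<delta>\<rfloor> + 1" by linarith+
      then show "\<delta> * of_int \<lfloor>x / \<delta>\<rfloor> \<le> x" "x \<le> \<delta> * (of_int \<lfloor>x / \<delta>\<rfloor> + 1)"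
        using \<delta> by (metis pos_le_divide_eq mult.commute, metis pos_divide_le_eq mult.commute)
    qed
    then have Q: "z \<in> ?Q i j" by (simp add: grid_cell_iff i_def j_def)
    then have S: "(i, j) \<in> S" using z by (auto simp: S_def)
    let ?B = "box (?p i j) (?p (i + 1) (j + 1))"
    show ?thesis
    proof (cases "z \<in> ?B")
      case True
      then show ?thesis using interior S by blast
    next
      case False
      have "?B \<noteq> {}" using \<delta> by (auto simp: box_ne_empty grid_point_def Basis_complex_def inner_complex_def)
      then have "z \<in> closure ?B" using Q by (simp add: closure_box grid_cell_def)
      then have limpt: "z islimpt ?B" using False by (simp add: closure_def)
      have "isCont R z"
        unfolding R_def
      proof (intro continuous_intros cauchy_segment_continuous)
        fix x assume x: "x \<in> I"
        show "continuous_on (closed_segment (a x) (b x)) f"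
          using segments[OF x] holomorphic_on_imp_continuous_on[OF f] continuous_on_subset by blast
        show "z \<notin> closed_segment (a x) (b x)" using segments[OF x] z by blast
      qed
      then have "(R \<longlongrightarrow> R z) (at z within ?B)" by (rule isContD[THEN tendsto_within_subset]) simp
      moreover have "isCont f z"
        using f \<Omega> K(2) z by (meson continuous_on_eq_continuous_at holomorphic_on_imp_continuous_on subsetD)
      then have "(f \<longlongrightarrow> f z) (at z within ?B)" by (rule isContD[THEN tendsto_within_subset]) simp
      then have "(R \<longlongrightarrow> f z) (at z within ?B)"
        by (rule Lim_transform_within[where d = 1]) (use interior S in auto)
      ultimately show ?thesis
        using limpt tendsto_unique trivial_limit_within by blast
    qed
  qed
  then have R: "f z = (\<Sum>x\<in>I. c x * contour_integral (linepath (a x) (b x)) (\<lambda>w. f w / (w - z)))"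
    if "z \<in> K" for z
    using that by (simp add: R_def)
  have "finite I" using fin by (simp add: I_def)
  then show thesis using segments R by (rule that)
qed

section \<open>Runge approximation\<close>

text \<open>The approximating family is arbitrary: it only has to be linear, to approximate polynomials, and to
approximate polynomials in \<open>1 / (s - a)\<close> for one point \<open>a\<close> in each bounded component of the complement of \<open>K\<close>.\<close>

theorem runge_approximation:
  assumes \<Omega>: "open \<Omega>" and K: "compact K" "K \<subseteq> \<Omega>" and f: "f holomorphic_on \<Omega>"
    and F: "linear_family F" and poly: "\<And>p. approximable_on K F (\<lambda>s. poly p s)"
    and holes: "\<And>U. U \<in> components (- K) \<Longrightarrow> bounded U \<Longrightarrow>
      \<exists>a\<in>U. \<forall>p. approximable_on K F (\<lambda>s. poly p (1 / (s - a)))"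
  shows "approximable_on K F f"
proof -
  obtain I :: "(int \<times> int + int \<times> int) set" and c a b where I:
    "finite I" "\<And>x. x \<in> I \<Longrightarrow> closed_segment (a x) (b x) \<subseteq> \<Omega> - K"
    "\<And>z. z \<in> K \<Longrightarrow> f z = (\<Sum>x\<in>I. c x * contour_integral (linepath (a x) (b x)) (\<lambda>w. f w / (w - z)))"
    by (rule Cauchy_grid_representation[OF \<Omega> K f]) (rule that)
  have pole: "approximable_on K F (\<lambda>s. 1 / (s - w))" if "w \<notin> K" for w
    using pole_pushing[OF K(1) poly holes that, of "[:0, 1:]"] by simp
  have "approximable_on K F (\<lambda>z. contour_integral (linepath (a x) (b x)) (\<lambda>w. f w / (w - z)))" if "x \<in> I" for x
  proof (rule cauchy_segment_approximable[OF K(1) F])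
    show "continuous_on (closed_segment (a x) (b x)) f"
      using I(2)[OF that] holomorphic_on_imp_continuous_on[OF f] continuous_on_subset by blast
  qed (use I(2)[OF that] pole in auto)
  then have "approximable_on K F (\<lambda>z. \<Sum>x\<in>I. c x * contour_integral (linepath (a x) (b x)) (\<lambda>w. f w / (w - z)))"
    by (intro approximable_on_sum approximable_on_scale F)
  then show ?thesis by (rule approximable_on_cong) (simp add: I(3))
qed

section \<open>Exhaustion by compact sets without superfluous holes\<close>

text \<open>Removing discs of fixed radius around all points outside \<open>\<Omega>\<close> makes sure that every component of the complement
either contains a point outside \<open>\<Omega>\<close> or reaches beyond the disc of radius \<open>n\<close>. For an arbitrary compact
subset of \<open>\<Omega>\<close>, a bounded complementary component may lie entirely in \<open>\<Omega>\<close>.\<close>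

definition exhaustion :: "complex set \<Rightarrow> nat \<Rightarrow> complex set" where
  "exhaustion \<Omega> n = cball 0 (real n) - (\<Union>w\<in>- \<Omega>. ball w (1 / real (Suc n)))"

lemma compact_exhaustion: "compact (exhaustion \<Omega> n)"
  unfolding exhaustion_def by (intro compact_diff compact_cball open_UN ballI open_ball)

lemma exhaustion_subset: "exhaustion \<Omega> n \<subseteq> \<Omega>"
  unfolding exhaustion_def by force

lemma eventually_subset_exhaustion:
  assumes "open \<Omega>" "compact K" "K \<subseteq> \<Omega>"
  shows "\<forall>\<^sub>F n in sequentially. K \<subseteq> exhaustion \<Omega> n"
proof -
  obtain r where r: "\<And>z. z \<in> K \<Longrightarrow> cmod z \<le> r"
    using compact_imp_bounded[OF assms(2)] unfolding bounded_iff by blast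
  obtain e where e: "e > 0" "(\<Union>z\<in>K. ball z e) \<subseteq> \<Omega>"
    using compact_subset_open_imp_ball_epsilon_subset[OF assms(2,1,3)] by blast
  have "\<forall>\<^sub>F n::nat in sequentially. r < real n" by real_asymp
  moreover have "\<forall>\<^sub>F n::nat in sequentially. 1 / real (Suc n) < e" using e(1) by real_asymp
  ultimately show ?thesis
  proof eventually_elim
    case (elim n)
    show ?case
    proof
      fix z assume z: "z \<in> K"
      have "z \<notin> ball w (1 / real (Suc n))" if w: "w \<notin> \<Omega>" for w
      proof
        assume "z \<in> ball w (1 / real (Suc n))"
        then have "w \<in> ball z e" using elim(2) by (simp add: dist_commute)
        then show False using e(2) z w by blast
      qed
      then show "z \<in> exhaustion \<Omega> n" using r[OF z] elim(1) by (auto simp: exhaustion_def)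
    qed
  qed
qed

text \<open>Take a point \<open>x\<close> of \<open>U\<close>. If \<open>\<bar>x\<bar> > n\<close>, then \<open>U\<close> absorbs the connected unbounded set outside the disc. So \<open>x\<close> lies
in one of the removed discs; the disc is connected, hence its centre lies in \<open>U\<close>, and so does the component of
the complement of \<open>\<Omega>\<close> through the centre.\<close>

lemma complement_component_exhaustion_contains_component:
  assumes U: "U \<in> components (- exhaustion \<Omega> n)" and "bounded U"
  obtains C where "C \<in> components (- \<Omega>)" "C \<subseteq> U"
proof -
  obtain x where x: "x \<in> U" using in_components_nonempty[OF U] by blast
  have absorb: "X \<subseteq> U" if "connected X" "X \<subseteq> - exhaustion \<Omega> n" "X \<inter> U \<noteq> {}" for X
    using components_maximal[OF U that(1,2)] that(3) by blast
  have "cmod x \<le> n"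
  proof (rule ccontr)
    assume "\<not> cmod x \<le> n"
    then have "- cball 0 (real n) \<inter> U \<noteq> {}" using x by auto
    moreover have "connected (- cball (0::complex) (real n))"
      by (intro connected_complement_bounded_convex) (auto simp: DIM_complex)
    ultimately have "- cball 0 (real n) \<subseteq> U" by (intro absorb) (auto simp: exhaustion_def)
    then have "bounded (- cball (0::complex) (real n))" using assms(2) bounded_subset by blast
    then have "bounded (UNIV :: complex set)"
      by (metis bounded_Un bounded_cball Compl_partition)
    then show False by simp
  qed
  moreover have "x \<notin> exhaustion \<Omega> n" using x in_components_subset[OF U] by blast
  ultimately obtain w where w: "w \<notin> \<Omega>" "x \<in> ball w (1 / real (Suc n))"
    by (auto simp: exhaustion_def)
  have "ball w (1 / real (Suc n)) \<subseteq> U"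
    by (rule absorb) (use w x in \<open>auto simp: exhaustion_def\<close>)
  moreover have "w \<in> ball w (1 / real (Suc n))" by simp
  ultimately have "w \<in> U" by blast
  let ?C = "connected_component_set (- \<Omega>) w"
  have "?C \<in> components (- \<Omega>)" using w by (simp add: componentsI)
  moreover have "?C \<subseteq> U"
  proof (rule absorb)
    show "?C \<subseteq> - exhaustion \<Omega> n"
      using connected_component_subset[of "- \<Omega>" w] exhaustion_subset[of \<Omega> n] by blast
    show "?C \<inter> U \<noteq> {}" using \<open>w \<in> U\<close> w(1) by (auto intro: connected_component_refl)
  qed simp
  ultimately show ?thesis by (rule that)
qed

section \<open>Sums of Dirichlet polynomials in shifted reciprocals\<close>

lemma dirichlet_approximantI:
  fixes N :: nat
  assumes "dirichlet_polynomial P\<^sub>0" "\<And>j. j \<in> {1..N} \<Longrightarrow> dirichlet_polynomial (P j) \<and> Some (z j) \<in> A"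
    "\<And>s. h s = P\<^sub>0 s + (\<Sum>j=1..N. P j (1 / (s - z j)))"
  shows "dirichlet_approximant A h"
proof -
  have "h = (\<lambda>s. P\<^sub>0 s + (\<Sum>j=1..N. P j (1 / (s - z j))))" using assms(3) by (rule ext)
  then show ?thesis unfolding dirichlet_approximant_def using assms(1,2) by blast
qed

lemma dirichlet_approximantE:
  assumes "dirichlet_approximant A h"
  obtains P\<^sub>0 and N :: nat and P z where "dirichlet_polynomial P\<^sub>0"
    "\<forall>j\<in>{1..N}. dirichlet_polynomial (P j) \<and> Some (z j) \<in> A"
    "h = (\<lambda>s. P\<^sub>0 s + (\<Sum>j=1..N. P j (1 / (s - z j))))"
  using assms unfolding dirichlet_approximant_def by (elim exE conjE) (rule that)

lemma dirichlet_polynomial_approximant: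
  "dirichlet_polynomial P \<Longrightarrow> dirichlet_approximant A P"
  by (rule dirichlet_approximantI[where N = 0]) auto

lemma dirichlet_approximant_add:
  assumes "dirichlet_approximant A g" "dirichlet_approximant A h"
  shows "dirichlet_approximant A (\<lambda>s. g s + h s)"
proof -
  obtain P\<^sub>0 and N :: nat and P z where P: "dirichlet_polynomial P\<^sub>0"
    "\<forall>j\<in>{1..N}. dirichlet_polynomial (P j) \<and> Some (z j) \<in> A"
    "g = (\<lambda>s. P\<^sub>0 s + (\<Sum>j=1..N. P j (1 / (s - z j))))"
    by (rule dirichlet_approximantE[OF assms(1)])
  obtain Q\<^sub>0 and M :: nat and Q w where Q: "dirichlet_polynomial Q\<^sub>0"
    "\<forall>j\<in>{1..M}. dirichlet_polynomial (Q j) \<and> Some (w j) \<in> A"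
    "h = (\<lambda>s. Q\<^sub>0 s + (\<Sum>j=1..M. Q j (1 / (s - w j))))"
    by (rule dirichlet_approximantE[OF assms(2)])
  define R where "R j = (if j \<le> N then P j else Q (j - N))" for j
  define v where "v j = (if j \<le> N then z j else w (j - N))" for j
  show ?thesis
  proof (rule dirichlet_approximantI)
    show "dirichlet_polynomial (\<lambda>s. P\<^sub>0 s + Q\<^sub>0 s)" by (rule dirichlet_polynomial_add[OF P(1) Q(1)])
    show "dirichlet_polynomial (R j) \<and> Some (v j) \<in> A" if "j \<in> {1..N + M}" for j
    proof (cases "j \<le> N")
      case True
      then show ?thesis using bspec[OF P(2), of j] that by (simp add: R_def v_def)
    next
      case False
      then have "j - N \<in> {1..M}" using that by auto
      then show ?thesis using bspec[OF Q(2), of "j - N"] False by (simp add: R_def v_def)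
    qed
    show "g s + h s = P\<^sub>0 s + Q\<^sub>0 s + (\<Sum>j=1..N + M. R j (1 / (s - v j)))" for s
    proof -
      have "(\<Sum>j=1..N + M. R j (1 / (s - v j))) =
          (\<Sum>j=1..N. R j (1 / (s - v j))) + (\<Sum>j=1 + N..M + N. R j (1 / (s - v j)))"
        by (subst sum.ub_add_nat) (simp_all add: add.commute)
      also have "(\<Sum>j=1..N. R j (1 / (s - v j))) = (\<Sum>j=1..N. P j (1 / (s - z j)))"
        by (intro sum.cong) (auto simp: R_def v_def)
      also have "(\<Sum>j=1 + N..M + N. R j (1 / (s - v j))) = (\<Sum>j=1..M. Q j (1 / (s - w j)))"
        unfolding sum.shift_bounds_cl_nat_ivl by (intro sum.cong) (auto simp: R_def v_def)
      finally show ?thesis by (simp add: P(3) Q(3))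
    qed
  qed
qed

lemma dirichlet_approximant_scale:
  assumes "dirichlet_approximant A h"
  shows "dirichlet_approximant A (\<lambda>s. c * h s)"
proof -
  obtain P\<^sub>0 and N :: nat and P z where P: "dirichlet_polynomial P\<^sub>0"
    "\<forall>j\<in>{1..N}. dirichlet_polynomial (P j) \<and> Some (z j) \<in> A"
    "h = (\<lambda>s. P\<^sub>0 s + (\<Sum>j=1..N. P j (1 / (s - z j))))"
    by (rule dirichlet_approximantE[OF assms])
  note scale = dirichlet_polynomial_mult[OF dirichlet_polynomial_const[of c]]
  show ?thesis
  proof (rule dirichlet_approximantI)
    show "dirichlet_polynomial (\<lambda>s. c * P\<^sub>0 s)" by (rule scale[OF P(1)])
    show "dirichlet_polynomial (\<lambda>s. c * P j s) \<and> Some (z j) \<in> A" if "j \<in> {1..N}" for j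
      using bspec[OF P(2) that] scale by blast
    show "c * h s = c * P\<^sub>0 s + (\<Sum>j=1..N. c * P j (1 / (s - z j)))" for s
      by (simp add: P(3) distrib_left sum_distrib_left)
  qed
qed

lemma linear_family_dirichlet_approximants: "linear_family {h. dirichlet_approximant A h}"
  unfolding linear_family_def
  by (auto intro: dirichlet_approximant_add dirichlet_approximant_scale
      dirichlet_polynomial_approximant dirichlet_polynomial_const)

lemma polynomial_approximable_by_dirichlet_approximants:
  assumes "bounded K"
  shows "approximable_on K {h. dirichlet_approximant A h} (\<lambda>s. poly p s)"
  by (rule approximable_on_trans[OF polynomial_approximable_by_dirichlet_polynomials[OF assms]])
     (simp add: approximable_on_member dirichlet_polynomial_approximant)

text \<open>The image of \<open>K\<close> under \<open>s \<mapsto> 1 / (s - a)\<close> is bounded, so the polynomial \<open>p\<close> is approximated there by a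
Dirichlet polynomial.\<close>

lemma principal_part_approximable_by_dirichlet_approximants:
  assumes K: "compact K" and a: "a \<notin> K" "Some a \<in> A"
  shows "approximable_on K {h. dirichlet_approximant A h} (\<lambda>s. poly p (1 / (s - a)))"
proof (rule approximable_onI)
  fix e :: real assume e: "e > 0"
  have "continuous_on K (\<lambda>s. 1 / (s - a))" using a(1) by (intro continuous_intros) auto
  then have "bounded ((\<lambda>s. 1 / (s - a)) ` K)" using K by (intro compact_imp_bounded compact_continuous_image)
  then obtain P where P: "dirichlet_polynomial P"
    "\<forall>w\<in>(\<lambda>s. 1 / (s - a)) ` K. cmod (P w - poly p w) < e"
    using polynomial_approximable_by_dirichlet_polynomials[of "(\<lambda>s. 1 / (s - a)) ` K" p] e
    unfolding approximable_on_def by blast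
  have "dirichlet_approximant A (\<lambda>s. P (1 / (s - a)))"
    by (rule dirichlet_approximantI[where N = 1 and P\<^sub>0 = "\<lambda>s. 0" and P = "\<lambda>j. P" and z = "\<lambda>j. a"])
       (use P(1) a(2) dirichlet_polynomial_const in auto)
  then show "\<exists>h. h \<in> {h. dirichlet_approximant A h} \<and> (\<forall>s\<in>K. cmod (h s - poly p (1 / (s - a))) < e)"
    using P(2) by (intro exI[of _ "\<lambda>s. P (1 / (s - a))"]) simp
qed

lemma dirichlet_approximant_holomorphic:
  assumes "dirichlet_approximant A h" "A \<subseteq> - (Some ` \<Omega>)"
  shows "h holomorphic_on \<Omega>"
proof -
  obtain P\<^sub>0 and N :: nat and P z where P: "dirichlet_polynomial P\<^sub>0"
    "\<forall>j\<in>{1..N}. dirichlet_polynomial (P j) \<and> Some (z j) \<in> A"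
    "h = (\<lambda>s. P\<^sub>0 s + (\<Sum>j=1..N. P j (1 / (s - z j))))"
    by (rule dirichlet_approximantE[OF assms(1)])
  have "(\<lambda>s. P j (1 / (s - z j))) holomorphic_on \<Omega>" if j: "j \<in> {1..N}" for j
  proof -
    have "z j \<notin> \<Omega>" using bspec[OF P(2) j] assms(2) by auto
    then have "(\<lambda>s. 1 / (s - z j)) holomorphic_on \<Omega>" by (intro holomorphic_intros) auto
    moreover have "P j holomorphic_on UNIV" using bspec[OF P(2) j] dirichlet_polynomial_holomorphic by blast
    ultimately have "(P j \<circ> (\<lambda>s. 1 / (s - z j))) holomorphic_on \<Omega>"
      by (rule holomorphic_on_compose_gen) simp
    then show ?thesis by (simp add: o_def)
  qed
  then show ?thesis
    unfolding P(3) using dirichlet_polynomial_holomorphic[OF P(1)] by (intro holomorphic_intros) auto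
qed

lemma holomorphic_approximable_by_dirichlet_approximants:
  assumes \<Omega>: "open \<Omega>"
    and holes: "\<And>C. C \<in> components (- \<Omega>) \<Longrightarrow> bounded C \<Longrightarrow> \<exists>z\<in>C. Some z \<in> A"
    and g: "g holomorphic_on \<Omega>"
  shows "approximable_on (exhaustion \<Omega> n) {h. dirichlet_approximant A h} g"
proof (rule runge_approximation[OF \<Omega> compact_exhaustion exhaustion_subset g linear_family_dirichlet_approximants])
  show "approximable_on (exhaustion \<Omega> n) {h. dirichlet_approximant A h} (\<lambda>s. poly p s)" for p
    by (intro polynomial_approximable_by_dirichlet_approximants compact_imp_bounded compact_exhaustion)
  fix U assume U: "U \<in> components (- exhaustion \<Omega> n)" "bounded U"
  then obtain C where C: "C \<in> components (- \<Omega>)" "C \<subseteq> U"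
    by (rule complement_component_exhaustion_contains_component)
  then obtain a where a: "a \<in> C" "Some a \<in> A" using holes bounded_subset[OF U(2)] by blast
  then have "a \<in> U" using C by blast
  moreover have "a \<notin> exhaustion \<Omega> n" using \<open>a \<in> U\<close> in_components_subset[OF U(1)] by blast
  ultimately show "\<exists>a\<in>U. \<forall>p. approximable_on (exhaustion \<Omega> n) {h. dirichlet_approximant A h} (\<lambda>s. poly p (1 / (s - a)))"
    using principal_part_approximable_by_dirichlet_approximants[OF compact_exhaustion _ a(2)] by blast
qed

section \<open>Chordal limits of holomorphic functions\<close>

text \<open>This is the triangle inequality through \<open>\<infinity>\<close>. It holds because \<open>x \<mapsto> sqrt (1 + x\<^sup>2)\<close>, the modulus of \<open>1 + \<i> x\<close>,
is \<open>1\<close>-Lipschitz.\<close>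

lemma chordal_infinity_lipschitz: "\<bar>chordal x None - chordal y None\<bar> \<le> chordal x y"
proof -
  have both: "\<bar>1 / sqrt (1 + (cmod a)\<^sup>2) - 1 / sqrt (1 + (cmod b)\<^sup>2)\<bar> \<le> chordal (Some a) (Some b)" for a b
  proof -
    define \<alpha> \<beta> where "\<alpha> = sqrt (1 + (cmod a)\<^sup>2)" and "\<beta> = sqrt (1 + (cmod b)\<^sup>2)"
    have pos: "\<alpha> > 0" "\<beta> > 0" by (simp_all add: \<alpha>_def \<beta>_def add_pos_nonneg)
    have "\<bar>\<alpha> - \<beta>\<bar> \<le> \<bar>cmod a - cmod b\<bar>"
      using norm_triangle_ineq3[of "Complex 1 (cmod a)" "Complex 1 (cmod b)"]
      by (simp add: \<alpha>_def \<beta>_def cmod_def)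
    also have "\<dots> \<le> cmod (a - b)" by (rule norm_triangle_ineq3)
    finally have le: "\<bar>\<alpha> - \<beta>\<bar> \<le> cmod (a - b)" .
    have "1 / \<alpha> - 1 / \<beta> = (\<beta> - \<alpha>) / (\<alpha> * \<beta>)" using pos by (simp add: field_simps)
    then have "\<bar>1 / \<alpha> - 1 / \<beta>\<bar> = \<bar>\<alpha> - \<beta>\<bar> / (\<alpha> * \<beta>)"
      using pos by (simp add: abs_minus_commute abs_mult)
    also have "\<dots> \<le> cmod (a - b) / (\<alpha> * \<beta>)" using le pos by (intro divide_right_mono) auto
    finally show ?thesis by (simp add: \<alpha>_def \<beta>_def)
  qed
  show ?thesis using both by (cases x; cases y) (auto simp: add_nonneg_nonneg)
qed

lemma chordal_infinity_pos: "chordal (Some a) None > 0"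
  by (simp add: add_pos_nonneg)

lemma chordal_le_dist: "chordal (Some a) (Some b) \<le> cmod (a - b)"
proof -
  have "1 \<le> sqrt (1 + (cmod a)\<^sup>2)" "1 \<le> sqrt (1 + (cmod b)\<^sup>2)" by simp_all
  then have "1 \<le> sqrt (1 + (cmod a)\<^sup>2) * sqrt (1 + (cmod b)\<^sup>2)"
    using mult_mono[of 1 _ 1] by fastforce
  then have "cmod (a - b) / (sqrt (1 + (cmod a)\<^sup>2) * sqrt (1 + (cmod b)\<^sup>2)) \<le> cmod (a - b) / 1"
    by (intro divide_left_mono) auto
  then show ?thesis by simp
qed

lemma chordal_finite_eq:
  "chordal (Some a) (Some b) = cmod (a - b) * (chordal (Some a) None * chordal (Some b) None)"
  by simp

lemma chordal_infinity_less_half: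
  assumes "chordal (Some a) None < 1 / 2"
  shows "cmod a > 1"
proof (rule ccontr)
  assume "\<not> cmod a > 1"
  then have "(cmod a)\<^sup>2 \<le> 1" by (simp add: power_le_one)
  then have "sqrt (1 + (cmod a)\<^sup>2) \<le> sqrt 4" by (intro real_sqrt_le_mono) simp
  then have "sqrt (1 + (cmod a)\<^sup>2) \<le> 2" by simp
  moreover have "0 < sqrt (1 + (cmod a)\<^sup>2)" by (simp add: add_pos_nonneg)
  ultimately have "1 / 2 \<le> chordal (Some a) None" by (simp add: frac_le)
  then show False using assms by simp
qed

text \<open>Inversion on the extended plane, with finite values: division by zero sends \<open>0\<close> to \<open>0\<close> instead of \<open>\<infinity>\<close>.\<close>

definition reciprocal :: "ecomplex \<Rightarrow> complex" where
  "reciprocal x = (case x of None \<Rightarrow> 0 | Some w \<Rightarrow> 1 / w)"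

text \<open>Inversion is an isometry of the chordal metric, and in the closed unit disc the chordal and the
Euclidean distance are comparable. The constant \<open>4\<close> comes from \<open>sqrt (1 + t\<^sup>2) \<le> 2 t\<close> for \<open>t > 1\<close>.\<close>

lemma reciprocal_chordal:
  assumes a: "cmod a > 1" and x: "\<And>b. x = Some b \<Longrightarrow> cmod b > 1"
  shows "cmod (1 / a - reciprocal x) \<le> 4 * chordal (Some a) x"
proof -
  have bound: "sqrt (1 + (cmod b)\<^sup>2) \<le> 2 * cmod b" if "cmod b > 1" for b
  proof (rule real_le_lsqrt)
    have "1 \<le> (cmod b)\<^sup>2" using that by simp
    then show "1 + (cmod b)\<^sup>2 \<le> (2 * cmod b)\<^sup>2" by (simp add: power_mult_distrib)
  qed simp
  have pos: "sqrt (1 + (cmod b)\<^sup>2) > 0" for b by (simp add: add_pos_nonneg)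
  show ?thesis
  proof (cases x)
    case None
    have "1 / (2 * cmod a) \<le> 1 / sqrt (1 + (cmod a)\<^sup>2)"
      using bound[OF a] pos[of a] by (intro frac_le) auto
    moreover have "0 \<le> 1 / sqrt (1 + (cmod a)\<^sup>2)" by simp
    moreover have "1 / cmod a = 2 * (1 / (2 * cmod a))" by simp
    ultimately have "1 / cmod a \<le> 4 * (1 / sqrt (1 + (cmod a)\<^sup>2))" by linarith
    then show ?thesis by (simp add: None reciprocal_def norm_divide)
  next
    case (Some b)
    have b: "cmod b > 1" using x Some .
    have "a \<noteq> 0" "b \<noteq> 0" using a b by auto
    then have "1 / a - 1 / b = (b - a) / (a * b)" by (simp add: field_simps)
    then have "cmod (1 / a - 1 / b) = cmod (a - b) / (cmod a * cmod b)"
      by (simp add: norm_divide norm_mult norm_minus_commute)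
    also have "\<dots> = 4 * (cmod (a - b) / ((2 * cmod a) * (2 * cmod b)))" by simp
    also have "\<dots> \<le> 4 * (cmod (a - b) / (sqrt (1 + (cmod a)\<^sup>2) * sqrt (1 + (cmod b)\<^sup>2)))"
      using bound[OF a] bound[OF b] pos[of a] pos[of b] \<open>a \<noteq> 0\<close> \<open>b \<noteq> 0\<close>
      by (intro mult_left_mono divide_left_mono mult_mono mult_pos_pos) auto
    finally show ?thesis by (simp add: Some reciprocal_def)
  qed
qed

lemma chordal_uniform_limitD:
  "chordal_uniform_limit K F f \<Longrightarrow> \<epsilon> > 0 \<Longrightarrow> \<forall>\<^sub>F k in sequentially. \<forall>s\<in>K. chordal (F k s) (f s) < \<epsilon>"
  by (simp add: chordal_uniform_limit_def)

lemma chordal_infinity_continuous: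
  assumes h: "\<And>k. continuous_on K (h k)"
    and lim: "chordal_uniform_limit K (\<lambda>k s. Some (h k s)) f"
  shows "continuous_on K (\<lambda>s. chordal (f s) None)"
proof (rule uniform_limit_theorem)
  have "sqrt (1 + (cmod w)\<^sup>2) \<noteq> 0" for w using chordal_infinity_pos[of w] by auto
  then show "\<forall>\<^sub>F k in sequentially. continuous_on K (\<lambda>s. chordal (Some (h k s)) None)"
    unfolding chordal.simps by (intro always_eventually allI continuous_intros h ballI)
  show "uniform_limit K (\<lambda>k s. chordal (Some (h k s)) None) (\<lambda>s. chordal (f s) None) sequentially"
  proof (rule uniform_limitI)
    fix e :: real assume "e > 0"
    from chordal_uniform_limitD[OF lim this]
    show "\<forall>\<^sub>F k in sequentially. \<forall>s\<in>K. dist (chordal (Some (h k s)) None) (chordal (f s) None) < e"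
      unfolding dist_real_def using chordal_infinity_lipschitz
      by (elim eventually_mono) (blast intro: le_less_trans)
  qed
qed simp

text \<open>The continuous function \<open>chordal (f s) None\<close> has a positive minimum \<open>c\<close> on \<open>K\<close>. By the Lipschitz estimate the values of
\<open>h k\<close> eventually stay at distance at least \<open>c / 2\<close> from \<open>\<infinity>\<close>, and at such distances from \<open>\<infinity>\<close> the Euclidean
distance is at most a constant times the chordal one.\<close>

lemma uniform_limit_where_finite:
  assumes K: "compact K" and h: "\<And>k. continuous_on K (h k)"
    and lim: "chordal_uniform_limit K (\<lambda>k s. Some (h k s)) f"
    and g: "\<And>s. s \<in> K \<Longrightarrow> f s = Some (g s)"
  shows "uniform_limit K h g sequentially"
proof (cases "K = {}")
  case False
  obtain t where t: "t \<in> K" "\<And>s. s \<in> K \<Longrightarrow> chordal (f t) None \<le> chordal (f s) None"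
    using continuous_attains_inf[OF K False chordal_infinity_continuous[OF h lim]] by blast
  define c where "c = chordal (f t) None"
  have c: "c > 0" using chordal_infinity_pos g[OF t(1)] by (simp add: c_def del: chordal.simps)
  show ?thesis
  proof (rule uniform_limitI)
    fix e :: real assume e: "e > 0"
    have "\<forall>\<^sub>F k in sequentially. \<forall>s\<in>K. chordal (Some (h k s)) (f s) < c / 2"
      using c by (intro chordal_uniform_limitD[OF lim]) simp
    moreover have "\<forall>\<^sub>F k in sequentially. \<forall>s\<in>K. chordal (Some (h k s)) (f s) < e * (c / 2 * c)"
      using c e by (intro chordal_uniform_limitD[OF lim]) simp
    ultimately show "\<forall>\<^sub>F k in sequentially. \<forall>s\<in>K. dist (h k s) (g s) < e"
    proof eventually_elim
      case (elim k)
      show ?case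
      proof
        fix s assume s: "s \<in> K"
        let ?x = "chordal (Some (h k s)) None" and ?y = "chordal (Some (g s)) None"
        have y: "c \<le> ?y" using t(2)[OF s] g[OF s] by (simp add: c_def del: chordal.simps)
        have near: "chordal (Some (h k s)) (Some (g s)) < c / 2"
          "chordal (Some (h k s)) (Some (g s)) < e * (c / 2 * c)"
          using bspec[OF elim(1) s] bspec[OF elim(2) s] unfolding g[OF s] .
        have x: "c / 2 \<le> ?x"
          using chordal_infinity_lipschitz[of "Some (h k s)" "Some (g s)"] near(1) y by linarith
        have "cmod (h k s - g s) * (c / 2 * c) \<le> cmod (h k s - g s) * (?x * ?y)"
          using x y c by (intro mult_left_mono mult_mono) auto
        also have "\<dots> < e * (c / 2 * c)"
          using near(2) unfolding chordal_finite_eq .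
        finally show "dist (h k s) (g s) < e"
          using c by (simp add: dist_norm)
      qed
    qed
  qed
qed simp

text \<open>On a small disc around \<open>z\<close> the values of \<open>f\<close> and, from an index \<open>k0\<close> on, those of \<open>h k\<close> have modulus greater than \<open>1\<close>.
The reciprocals \<open>G k\<close> are then holomorphic without zeros and converge uniformly to the reciprocal of \<open>f\<close>, which
is \<open>0\<close> at \<open>z\<close>; Hurwitz's theorem makes the limit constant.\<close>

lemma chordal_limit_infinite_nearby:
  assumes r: "r > 0" and h: "\<And>k. h k holomorphic_on cball z r"
    and lim: "chordal_uniform_limit (cball z r) (\<lambda>k s. Some (h k s)) f"
    and inf: "f z = None"
  obtains d where "d > 0" "\<And>s. s \<in> ball z d \<Longrightarrow> f s = None"
proof -
  have cont: "continuous_on (cball z r) (\<lambda>s. chordal (f s) None)"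
    using h lim by (intro chordal_infinity_continuous) (auto intro: holomorphic_on_imp_continuous_on)
  have "z \<in> cball z r" using r by simp
  then obtain d' where d': "d' > 0"
    "\<forall>s\<in>cball z r. dist s z < d' \<longrightarrow> dist (chordal (f s) None) (chordal (f z) None) < 1 / 4"
    using cont[unfolded continuous_on_iff, rule_format, of z "1 / 4"] by auto
  \<comment> \<open>Halving \<open>d'\<close> gives a closed disc on which the estimate holds.\<close>
  define d where "d = min r (d' / 2)"
  have d: "d > 0" "cball z d \<subseteq> cball z r" using r d'(1) by (auto simp: d_def)
  have small: "chordal (f s) None < 1 / 4" if "s \<in> cball z d" for s
  proof -
    have "s \<in> cball z r" using that d(2) by blast
    moreover have "dist s z < d'" using that d'(1) by (simp add: d_def dist_commute)
    ultimately have "dist (chordal (f s) None) (chordal (f z) None) < 1 / 4" using d'(2) by blast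
    moreover have "chordal (f z) None = 0" using inf by simp
    ultimately show ?thesis by (simp only: dist_real_def)
  qed
  have lim_d: "chordal_uniform_limit (cball z d) (\<lambda>k s. Some (h k s)) f"
    using lim d(2) unfolding chordal_uniform_limit_def by (fast elim!: eventually_mono)
  have big: "cmod w > 1" if "s \<in> cball z d" "f s = Some w" for s w
    using small[OF that(1)] unfolding that(2) by (intro chordal_infinity_less_half) linarith
  have "\<forall>\<^sub>F k in sequentially. \<forall>s\<in>cball z d. chordal (Some (h k s)) (f s) < 1 / 4"
    by (rule chordal_uniform_limitD[OF lim_d]) simp
  then obtain k0 where k0: "\<forall>k\<ge>k0. \<forall>s\<in>cball z d. chordal (Some (h k s)) (f s) < 1 / 4"
    unfolding eventually_sequentially by (elim exE)
  define G where "G k s = 1 / h (k + k0) s" for k s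
  define g where "g s = reciprocal (f s)" for s
  have hbig: "cmod (h (k + k0) s) > 1" if s: "s \<in> cball z d" for k s
  proof (rule chordal_infinity_less_half)
    show "chordal (Some (h (k + k0) s)) None < 1 / 2"
      using chordal_infinity_lipschitz[of "Some (h (k + k0) s)" "f s"] k0[rule_format, OF le_add2[of k0 k] s] small[OF s]
      by linarith
  qed
  have hnz: "h (k + k0) s \<noteq> 0" if "s \<in> ball z d" for k s
    using hbig[of s k] that by auto
  have unif: "uniform_limit (cball z d) G g sequentially"
  proof (rule uniform_limitI)
    fix e :: real assume e: "e > 0"
    have "\<forall>\<^sub>F k in sequentially. \<forall>s\<in>cball z d. chordal (Some (h k s)) (f s) < e / 4"
      using e by (intro chordal_uniform_limitD[OF lim_d]) simp
    then have "\<forall>\<^sub>F k in sequentially. \<forall>s\<in>cball z d. chordal (Some (h (k + k0) s)) (f s) < e / 4"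
      by (rule sequentially_offset)
    then show "\<forall>\<^sub>F k in sequentially. \<forall>s\<in>cball z d. dist (G k s) (g s) < e"
    proof eventually_elim
      case (elim k)
      show ?case
      proof
        fix s assume s: "s \<in> cball z d"
        have "cmod (G k s - g s) \<le> 4 * chordal (Some (h (k + k0) s)) (f s)"
          unfolding G_def g_def using hbig[OF s] big[OF s] by (intro reciprocal_chordal)
        also have "\<dots> < e" using bspec[OF elim s] by linarith
        finally show "dist (G k s) (g s) < e" by (simp only: dist_norm)
      qed
    qed
  qed
  have G: "G k holomorphic_on ball z d" for k
  proof -
    have "h (k + k0) holomorphic_on ball z d"
      by (rule holomorphic_on_subset[OF h order_trans[OF ball_subset_cball d(2)]])
    then show ?thesis
      unfolding G_def by (intro holomorphic_intros hnz)
  qed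
  have g: "g holomorphic_on ball z d"
  proof (rule holomorphic_uniform_sequence[OF open_ball G])
    fix x assume "x \<in> ball z d"
    then obtain \<delta> where \<delta>: "\<delta> > 0" "cball x \<delta> \<subseteq> ball z d"
      using open_ball[of z d] unfolding open_contains_cball by blast
    then have "uniform_limit (cball x \<delta>) G g sequentially"
      by (intro uniform_limit_on_subset[OF unif] order_trans[OF \<delta>(2) ball_subset_cball])
    with \<delta> show "\<exists>d'>0. cball x d' \<subseteq> ball z d \<and> uniform_limit (cball x d') G g sequentially"
      by (intro exI[of _ \<delta>] conjI)
  qed
  have "g z = 0" by (simp add: g_def inf reciprocal_def)
  have "g constant_on ball z d"
  proof (rule ccontr)
    assume nonconst: "\<not> g constant_on ball z d"
    have "g z \<noteq> 0"
    proof (rule Hurwitz_no_zeros[OF open_ball connected_ball G g _ nonconst])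
      show "uniform_limit K G g sequentially" if "compact K" "K \<subseteq> ball z d" for K
        by (rule uniform_limit_on_subset[OF unif order_trans[OF that(2) ball_subset_cball]])
      show "G k s \<noteq> 0" if "s \<in> ball z d" for k s
        using hnz[OF that] by (simp add: G_def)
    qed (use d in auto)
    then show False using \<open>g z = 0\<close> by simp
  qed
  then have zero: "g s = 0" if "s \<in> ball z d" for s
    using that \<open>g z = 0\<close> d(1) unfolding constant_on_def by (metis centre_in_ball)
  show ?thesis
  proof (rule that[OF d(1)])
    fix s assume s: "s \<in> ball z d"
    show "f s = None"
    proof (cases "f s")
      case (Some w)
      then have "w \<noteq> 0" using big[of s w] s by auto
      then show ?thesis using zero[OF s] Some by (simp add: g_def reciprocal_def)
    qed
  qed
qed

theorem chordal_limit_infinite_or_holomorphic: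
  assumes \<Omega>: "open \<Omega>" "connected \<Omega>" and h: "\<And>k. h k holomorphic_on \<Omega>"
    and lim: "\<And>K. compact K \<Longrightarrow> K \<subseteq> \<Omega> \<Longrightarrow> chordal_uniform_limit K (\<lambda>k s. Some (h k s)) f"
  shows "infinite_or_holomorphic_on f \<Omega>"
proof -
  define N where "N = {s \<in> \<Omega>. f s = None}"
  define M where "M = {s \<in> \<Omega>. f s \<noteq> None}"
  have hc: "continuous_on K (h k)" if "K \<subseteq> \<Omega>" for K k
    using h that by (meson holomorphic_on_imp_continuous_on holomorphic_on_subset)
  have "open N"
    unfolding open_contains_ball
  proof
    fix z assume "z \<in> N"
    then have z: "z \<in> \<Omega>" "f z = None" by (auto simp: N_def)
    then obtain r where r: "r > 0" "cball z r \<subseteq> \<Omega>" using \<Omega>(1) open_contains_cball by blast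
    obtain d where d: "d > 0" "\<And>s. s \<in> ball z d \<Longrightarrow> f s = None"
      using chordal_limit_infinite_nearby[of r h z f, OF r(1) _ lim[OF compact_cball r(2)] z(2)]
        holomorphic_on_subset[OF h r(2)] by blast
    have "ball z (min d r) \<subseteq> N" using d(2) r(2) by (auto simp: N_def)
    then show "\<exists>e>0. ball z e \<subseteq> N" using d(1) r(1) by (intro exI[of _ "min d r"]) auto
  qed
  have "open M"
    unfolding open_contains_ball
  proof
    fix z assume "z \<in> M"
    then have z: "z \<in> \<Omega>" "f z \<noteq> None" by (auto simp: M_def)
    then obtain r where r: "r > 0" "cball z r \<subseteq> \<Omega>" using \<Omega>(1) open_contains_cball by blast
    obtain w where "f z = Some w" using z(2) by blast
    then have pos: "chordal (f z) None > 0" by (simp only: chordal_infinity_pos)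
    have "continuous_on (cball z r) (\<lambda>s. chordal (f s) None)"
      using hc[OF r(2)] lim[OF compact_cball r(2)] by (rule chordal_infinity_continuous)
    note cont = this
    have "z \<in> cball z r" using r(1) by simp
    then obtain d where d: "d > 0" "\<forall>s\<in>cball z r. dist s z < d \<longrightarrow>
        dist (chordal (f s) None) (chordal (f z) None) < chordal (f z) None"
      using cont[unfolded continuous_on_iff, rule_format, of z "chordal (f z) None"] pos by auto
    have "s \<in> M" if "s \<in> ball z (min d r)" for s
    proof -
      have "s \<in> cball z r" "dist s z < d" using that by (auto simp: dist_commute)
      then have "dist (chordal (f s) None) (chordal (f z) None) < chordal (f z) None" using d(2) by blast
      then have "chordal (f s) None \<noteq> 0" unfolding dist_real_def by linarith
      then have "f s \<noteq> None" by (metis chordal.simps(4))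
      then show ?thesis using \<open>s \<in> cball z r\<close> r(2) by (auto simp: M_def)
    qed
    then show "\<exists>e>0. ball z e \<subseteq> M" using d(1) r(1) by (intro exI[of _ "min d r"]) auto
  qed
  have cover: "N \<inter> M \<inter> \<Omega> = {}" "\<Omega> \<subseteq> N \<union> M" and "N \<inter> \<Omega> = N" "M \<inter> \<Omega> = M"
    unfolding N_def M_def by blast+
  then have "N = {} \<or> M = {}"
    using connectedD[OF \<Omega>(2) \<open>open N\<close> \<open>open M\<close> cover] by (simp only:)
  then show ?thesis
  proof
    assume "M = {}"
    then show ?thesis by (auto simp: M_def infinite_or_holomorphic_on_def)
  next
    assume "N = {}"
    define g where "g s = the (f s)" for s
    have g: "f s = Some (g s)" if "s \<in> \<Omega>" for s
      using that \<open>N = {}\<close> by (auto simp: N_def g_def)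
    have "g holomorphic_on \<Omega>"
    proof (rule holomorphic_uniform_sequence[OF \<Omega>(1) h])
      fix z assume "z \<in> \<Omega>"
      then obtain r where r: "r > 0" "cball z r \<subseteq> \<Omega>" using \<Omega>(1) open_contains_cball by blast
      moreover have "uniform_limit (cball z r) h g sequentially"
        by (rule uniform_limit_where_finite[OF compact_cball hc[OF r(2)] lim[OF compact_cball r(2)]])
           (rule g[OF subsetD[OF r(2)]])
      ultimately show "\<exists>d>0. cball z d \<subseteq> \<Omega> \<and> uniform_limit (cball z d) h g sequentially" by blast
    qed
    then show ?thesis using g unfolding infinite_or_holomorphic_on_def by blast
  qed
qed

section \<open>Density\<close>

lemma dirichlet_approximants_dense:
  assumes \<Omega>: "open \<Omega>"
    and holes: "\<And>C. C \<in> components (- \<Omega>) \<Longrightarrow> bounded C \<Longrightarrow> \<exists>z\<in>C. Some z \<in> A"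
    and f: "infinite_or_holomorphic_on f \<Omega>"
  shows "\<exists>h. (\<forall>k. dirichlet_approximant A (h k)) \<and>
      (\<forall>K. compact K \<and> K \<subseteq> \<Omega> \<longrightarrow> chordal_uniform_limit K (\<lambda>k s. Some (h k s)) f)"
proof (cases "\<forall>s\<in>\<Omega>. f s = None")
  case True
  have "((\<lambda>k. 1 / sqrt (1 + (real k)\<^sup>2)) \<longlongrightarrow> 0) sequentially" by real_asymp
  then have "chordal_uniform_limit K (\<lambda>k s. Some (of_nat k)) f" if "K \<subseteq> \<Omega>" for K
    unfolding chordal_uniform_limit_def
    using True that by (auto dest!: order_tendstoD(2) elim!: eventually_mono simp: subset_iff)
  then show ?thesis
    by (intro exI[of _ "\<lambda>k s. of_nat k"])
       (auto intro: dirichlet_polynomial_approximant dirichlet_polynomial_const)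
next
  case False
  then obtain g where g: "g holomorphic_on \<Omega>" "\<And>s. s \<in> \<Omega> \<Longrightarrow> f s = Some (g s)"
    using f unfolding infinite_or_holomorphic_on_def by blast
  have "\<exists>h. dirichlet_approximant A h \<and> (\<forall>s\<in>exhaustion \<Omega> n. cmod (h s - g s) < 1 / real (Suc n))" for n
    using holomorphic_approximable_by_dirichlet_approximants[OF \<Omega> holes g(1), of n]
    unfolding approximable_on_def by auto
  then obtain h where h: "\<And>n. dirichlet_approximant A (h n)"
    "\<And>n s. s \<in> exhaustion \<Omega> n \<Longrightarrow> cmod (h n s - g s) < 1 / real (Suc n)" by metis
  have "chordal_uniform_limit K (\<lambda>k s. Some (h k s)) f" if K: "compact K" "K \<subseteq> \<Omega>" for K
    unfolding chordal_uniform_limit_def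
  proof (intro allI impI)
    fix e :: real assume e: "e > 0"
    have "\<forall>\<^sub>F n in sequentially. 1 / real (Suc n) < e" using e by real_asymp
    with eventually_subset_exhaustion[OF \<Omega> K]
    show "\<forall>\<^sub>F n in sequentially. \<forall>s\<in>K. chordal (Some (h n s)) (f s) < e"
    proof eventually_elim
      case (elim n)
      show ?case
      proof
        fix s assume s: "s \<in> K"
        have "chordal (Some (h n s)) (Some (g s)) \<le> cmod (h n s - g s)" by (rule chordal_le_dist)
        also have "\<dots> < 1 / real (Suc n)" using h(2) elim(1) s by blast
        also have "\<dots> < e" by (rule elim(2))
        finally show "chordal (Some (h n s)) (f s) < e" using g(2) s K(2) by auto
      qed
    qed
  qed
  then show ?thesis using h(1) by blast
qed

theorem theorem5p5:
  fixes \<Omega> :: "complex set" and A :: "ecomplex set"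
  assumes "open \<Omega>" and "connected \<Omega>" and "\<Omega> \<noteq> {}"
    and "A \<subseteq> - (Some ` \<Omega>)"
    and "None \<in> A"
    and "\<And>C. C \<in> components (- \<Omega>) \<Longrightarrow> bounded C \<Longrightarrow> \<exists>z\<in>C. Some z \<in> A"
  shows
    "(\<forall>f :: complex \<Rightarrow> ecomplex.
        infinite_or_holomorphic_on f \<Omega> \<longrightarrow>
        (\<exists>h :: nat \<Rightarrow> complex \<Rightarrow> complex.
           (\<forall>k. dirichlet_approximant A (h k)) \<and>
           (\<forall>K. compact K \<and> K \<subseteq> \<Omega> \<longrightarrow>
              chordal_uniform_limit K (\<lambda>k s. Some (h k s)) f)))
     \<and>
     (\<forall>(f :: complex \<Rightarrow> ecomplex) (h :: nat \<Rightarrow> complex \<Rightarrow> complex).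
        (\<forall>k. dirichlet_approximant A (h k)) \<and>
        (\<forall>K. compact K \<and> K \<subseteq> \<Omega> \<longrightarrow>
           chordal_uniform_limit K (\<lambda>k s. Some (h k s)) f) \<longrightarrow>
        infinite_or_holomorphic_on f \<Omega>)"
proof (intro conjI allI impI)
  fix f assume "infinite_or_holomorphic_on f \<Omega>"
  then show "\<exists>h. (\<forall>k. dirichlet_approximant A (h k)) \<and>
      (\<forall>K. compact K \<and> K \<subseteq> \<Omega> \<longrightarrow> chordal_uniform_limit K (\<lambda>k s. Some (h k s)) f)"
    using assms by (intro dirichlet_approximants_dense)
next
  fix f and h :: "nat \<Rightarrow> complex \<Rightarrow> complex"
  assume h: "(\<forall>k. dirichlet_approximant A (h k)) \<and>
      (\<forall>K. compact K \<and> K \<subseteq> \<Omega> \<longrightarrow> chordal_uniform_limit K (\<lambda>k s. Some (h k s)) f)"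
  show "infinite_or_holomorphic_on f \<Omega>"
  proof (rule chordal_limit_infinite_or_holomorphic[OF assms(1,2)])
    show "h k holomorphic_on \<Omega>" for k
      using h by (intro dirichlet_approximant_holomorphic[OF _ assms(4)]) blast
    show "chordal_uniform_limit K (\<lambda>k s. Some (h k s)) f" if "compact K" "K \<subseteq> \<Omega>" for K
      using h that by blast
  qed
qed

end
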